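(* A function $f\in L^2_V(\mathbb{T})$ belongs to $H_{W,V}(\mathbb{T})$ if, and only if, there are a function $F\in L^2_{W,0}(\mathbb{T})$ and a finite constant $c$ such that $$f(x)=c+\int_{(0,x]}F(s)\,dW(s)\qquad V\text{-a.e.}$$ Furthermore, in such a case the function $F$ is unique (as an element of $L^2_W(\mathbb{T})$).
   Context: Notation. $\mathbb{T}=\mathbb{R}/\mathbb{Z}$, identified with $[0,1)$; functions on $\mathbb{T}$ are identified with $1$-periodic functions on $\mathbb{R}$. Càdlàg means right-continuous with left limits; càglàd means left-continuous with right limits. $W,V:\mathbb{R}\to\mathbb{R}$ are strictly increasing, $W$ is càdlàg, $V$ is càglàd, and $W(x+1)-W(x)=W(1)-W(0)$, $V(x+1)-V(x)=V(1)-V(0)$ for all $x\in\mathbb{R}$; both are continuous at $0$ and $W(0)=V(0)=0$. No further continuity is assumed. $dW$ and $dV$ are the induced finite Borel measures on $\mathbb{T}$, with $dW((a,b])=W(b)-W(a)$ and $dV([a,b))=V(b)-V(a)$. $L^2_W(\mathbb{T})$, $L^2_V(\mathbb{T})$ are the corresponding (real) $L^2$ spaces; $\langle\cdot,\cdot\rangle_V$ is the inner product of $L^2_V(\mathbb{T})$; $L^2_{W,0}(\mathbb{T})=\{F\in L^2_W(\mathbb{T}):\int_{\mathbb{T}}F\,dW=0\}$. Lateral derivatives: $D^-_Wf(x)=\lim_{h\to0^-}\frac{f(x+h)-f(x)}{W(x+h)-W(x)}$ and $D^+_Vg(x)=\lim_{h\to0^+}\frac{g(x+h)-g(x)}{V(x+h)-V(x)}$;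 a function is $W$-left (resp. $V$-right) differentiable if the limit exists at every $x\in\mathbb{T}$. $\mathfrak{D}_{W,V}(\mathbb{T})$ is the set of càdlàg $f:\mathbb{T}\to\mathbb{R}$ that are $W$-left differentiable, with $D^-_Wf$ càglàd and $V$-right differentiable, and $D^+_VD^-_Wf$ càdlàg. $H_{W,V}(\mathbb{T})$ is the energetic space of $I-D^+_VD^-_W$ on $\mathfrak{D}_{W,V}(\mathbb{T})$: with the energetic norm $\|f\|_{1,2}^2=\langle(I-D^+_VD^-_W)f,f\rangle_V$ on $\mathfrak{D}_{W,V}(\mathbb{T})$, a function $f\in L^2_V(\mathbb{T})$ belongs to $H_{W,V}(\mathbb{T})$ iff there is a sequence $(f_n)$ in $\mathfrak{D}_{W,V}(\mathbb{T})$ with $f_n\to f$ in $L^2_V(\mathbb{T})$ and $(f_n)$ Cauchy with respect to $\|\cdot\|_{1,2}$. *)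

theory Defs
  imports "HOL-Analysis.Analysis"
begin

text \<open>
  The circle is represented by its fundamental domain \<open>{0..<1}\<close>.  An element of an $L^2$ space over
  the circle is given by a representative of type \<open>real \<Rightarrow> real\<close> whose values outside \<open>{0..<1}\<close>
  are irrelevant; equality in $L^2$ is equality almost everywhere.  Functions to which one-sided
  limits are applied are 1-periodic functions on the whole line, so that limits at \<open>0\<close> see the
  circle and not just the interval.
\<close>

definition periodic1 :: "(real \<Rightarrow> real) \<Rightarrow> bool" where
  "periodic1 f \<longleftrightarrow> (\<forall>x. f (x + 1) = f x)"

definition periodic_increments :: "(real \<Rightarrow> real) \<Rightarrow> bool" where
  "periodic_increments W \<longleftrightarrow> (\<forall>x. W (x + 1) - W x = W 1 - W 0)"

definition cadlag :: "(real \<Rightarrow> real) \<Rightarrow> bool" where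
  "cadlag f \<longleftrightarrow> (\<forall>x. continuous (at_right x) f \<and> (\<exists>l. (f \<longlongrightarrow> l) (at_left x)))"

definition caglad :: "(real \<Rightarrow> real) \<Rightarrow> bool" where
  "caglad f \<longleftrightarrow> (\<forall>x. continuous (at_left x) f \<and> (\<exists>l. (f \<longlongrightarrow> l) (at_right x)))"

text \<open>
  The library's \<^const>\<open>interval_measure\<close> expects a right-continuous function; for a
  left-continuous \<open>V\<close> the measure is obtained by reflection, which gives \<open>{a..<b}\<close> the
  mass \<open>V b - V a\<close> (see the lemma below).
\<close>

definition left_interval_measure :: "(real \<Rightarrow> real) \<Rightarrow> real measure" where
  "left_interval_measure V = distr (interval_measure (\<lambda>x. - V (- x))) borel uminus"

lemma emeasure_left_interval_measure:
  assumes "a \<le> b" and mono: "mono V" and cont: "\<And>x. continuous (at_left x) V"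
  shows "emeasure (left_interval_measure V) {a..<b} = ennreal (V b - V a)"
proof -
  let ?U = "\<lambda>x. - V (- x)"
  have U_mono: "?U x \<le> ?U y" if "x \<le> y" for x y
    using that mono by (simp add: mono_def)
  have U_cont: "continuous (at_right x) ?U" for x
  proof -
    have "(V \<longlongrightarrow> V (- x)) (at_left (- x))"
      using cont[of "- x"] by (simp add: continuous_within)
    then have "((\<lambda>y. V (- y)) \<longlongrightarrow> V (- x)) (at_right x)"
      by (subst (asm) at_left_minus) (simp add: filterlim_filtermap)
    then show ?thesis
      by (simp add: continuous_within tendsto_minus)
  qed
  have "uminus -` {a..<b} = {- b<..- a}"
    by auto
  then have "emeasure (left_interval_measure V) {a..<b} = emeasure (interval_measure ?U) {- b<..- a}"
    by (simp add: left_interval_measure_def emeasure_distr)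
  also have "\<dots> = ennreal (?U (- a) - ?U (- b))"
    using \<open>a \<le> b\<close> U_mono U_cont by (intro emeasure_interval_measure_Ioc) auto
  finally show ?thesis
    by simp
qed

definition dW :: "(real \<Rightarrow> real) \<Rightarrow> real measure" where
  "dW W = restrict_space (interval_measure W) {0..<1}"

definition dV :: "(real \<Rightarrow> real) \<Rightarrow> real measure" where
  "dV V = restrict_space (left_interval_measure V) {0..<1}"

definition L2 :: "real measure \<Rightarrow> (real \<Rightarrow> real) set" where
  "L2 M = {f. f \<in> borel_measurable M \<and> integrable M (\<lambda>x. (f x)\<^sup>2)}"

definition L2_zero_mean :: "real measure \<Rightarrow> (real \<Rightarrow> real) set" where
  "L2_zero_mean M = {F \<in> L2 M. (LINT x|M. F x) = 0}"

definition L2_inner :: "real measure \<Rightarrow> (real \<Rightarrow> real) \<Rightarrow> (real \<Rightarrow> real) \<Rightarrow> real" where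
  "L2_inner M f g = (LINT x|M. f x * g x)"

definition L2_norm :: "real measure \<Rightarrow> (real \<Rightarrow> real) \<Rightarrow> real" where
  "L2_norm M f = sqrt (L2_inner M f f)"

definition W_left_differentiable :: "(real \<Rightarrow> real) \<Rightarrow> (real \<Rightarrow> real) \<Rightarrow> bool" where
  "W_left_differentiable W f \<longleftrightarrow>
     (\<forall>x. \<exists>l. ((\<lambda>h. (f (x + h) - f x) / (W (x + h) - W x)) \<longlongrightarrow> l) (at_left 0))"

definition V_right_differentiable :: "(real \<Rightarrow> real) \<Rightarrow> (real \<Rightarrow> real) \<Rightarrow> bool" where
  "V_right_differentiable V g \<longleftrightarrow>
     (\<forall>x. \<exists>l. ((\<lambda>h. (g (x + h) - g x) / (V (x + h) - V x)) \<longlongrightarrow> l) (at_right 0))"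

definition D_left :: "(real \<Rightarrow> real) \<Rightarrow> (real \<Rightarrow> real) \<Rightarrow> real \<Rightarrow> real" where
  "D_left W f x = Lim (at_left 0) (\<lambda>h. (f (x + h) - f x) / (W (x + h) - W x))"

definition D_right :: "(real \<Rightarrow> real) \<Rightarrow> (real \<Rightarrow> real) \<Rightarrow> real \<Rightarrow> real" where
  "D_right V g x = Lim (at_right 0) (\<lambda>h. (g (x + h) - g x) / (V (x + h) - V x))"

definition D_space :: "(real \<Rightarrow> real) \<Rightarrow> (real \<Rightarrow> real) \<Rightarrow> (real \<Rightarrow> real) set" where
  "D_space W V = {f. periodic1 f \<and> cadlag f \<and>
     W_left_differentiable W f \<and> caglad (D_left W f) \<and>
     V_right_differentiable V (D_left W f) \<and> cadlag (D_right V (D_left W f))}"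

definition energetic_norm :: "(real \<Rightarrow> real) \<Rightarrow> (real \<Rightarrow> real) \<Rightarrow> (real \<Rightarrow> real) \<Rightarrow> real" where
  "energetic_norm W V f = sqrt (L2_inner (dV V) (\<lambda>x. f x - D_right V (D_left W f) x) f)"

definition H_space :: "(real \<Rightarrow> real) \<Rightarrow> (real \<Rightarrow> real) \<Rightarrow> (real \<Rightarrow> real) set" where
  "H_space W V = {f \<in> L2 (dV V). \<exists>fs :: nat \<Rightarrow> real \<Rightarrow> real.
     (\<forall>n. fs n \<in> D_space W V) \<and>
     (\<lambda>n. L2_norm (dV V) (\<lambda>x. fs n x - f x)) \<longlonglongrightarrow> 0 \<and>
     (\<forall>e>0. \<exists>N. \<forall>m\<ge>N. \<forall>n\<ge>N. energetic_norm W V (\<lambda>x. fs m x - fs n x) < e)}"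

end

theory Submission
  imports Defs
begin

text \<open>
  The energy of a function \<open>f\<close> of \<open>\<DD>\<close>, the domain of lateral derivatives, is
  \[ \langle (I - D^+_V D^-_W) f, f \rangle_V
     = \int f^2 \, dV + \int (D^-_W f)^2 \, dW . \]
  Hence a sequence that is Cauchy in energy has derivatives that are Cauchy in $L^2_W$, and these
  converge to some \<open>F\<close>.  Each member of the sequence is the primitive of its derivative with
  respect to \<open>dW\<close>, up to the constant given by its value at \<open>0\<close>; integration over \<open>(0,x]\<close> is
  continuous on $L^2_W$ uniformly in \<open>x\<close>, so the limit is a constant plus the primitive of \<open>F\<close>.
  Conversely, given \<open>F\<close> of mean zero, one approximates it in $L^2_W$ by functions \<open>g\<close> of mean zero
  that occur as derivatives \<open>D\<^sup>-\<^sub>W f\<close>; the primitives of these \<open>g\<close> converge in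
  energy.

  Three tools carry the argument.

  \<^item> A fundamental theorem of calculus for lateral derivatives.  A right-continuous function whose
    left derivative with respect to \<open>W\<close> vanishes everywhere is constant
    (\<open>left_deriv_0_imp_constant\<close>), whatever the jumps of \<open>W\<close>.  So a function is determined by its
    derivative and equals the primitive of it (\<open>integral_left_deriv\<close>), and the primitive of a
    periodic function of mean zero is periodic (\<open>periodic_primitive\<close>).  The statements about right
    derivatives with respect to \<open>V\<close> follow by the reflection \<open>x \<mapsto> - x\<close>.  With Fubini's
    theorem this gives integration by parts, and the energy identity (\<open>energetic_norm_eq\<close>).

  \<^item> A density principle (\<open>L2_induct\<close>): a class of functions closed under linear combinations and
    dominated pointwise limits that contains the indicators of the rays \<open>{..x}\<close> contains all of
    $L^2$.  An indicator of a ray is a pointwise limit of functions with a right derivative with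
    respect to \<open>V\<close> (\<open>flux_step\<close>), which drop from \<open>1\<close> to \<open>0\<close> just to the right of \<open>x\<close> and climb
    back just to the left of \<open>1\<close>, as periodicity requires.

  \<^item> Uniqueness of \<open>F\<close> uses the density principle once more.  As \<open>V\<close> is strictly increasing, \<open>dV\<close>
    charges every interval, so two representations of \<open>f\<close> have primitives that differ by a
    constant everywhere.  The difference of the two densities is then orthogonal to all rays, hence
    to itself.
\<close>

section \<open>Square-integrable functions on a finite measure space\<close>

text \<open>
  The measures of interest live on the circle, cut open to an interval of the line.
\<close>

locale finite_line_measure = finite_measure M for M :: "real measure"
begin

lemma L2_integrable: "u \<in> L2 M \<Longrightarrow> integrable M u"
  unfolding L2_def by (simp add: square_integrable_imp_integrable)

lemma L2_mult_integrable:
  assumes "u \<in> L2 M" "v \<in> L2 M"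
  shows "integrable M (\<lambda>x. u x * v x)"
proof (rule Bochner_Integration.integrable_bound)
  show "integrable M (\<lambda>x. (u x)\<^sup>2 + (v x)\<^sup>2)"
    using assms by (auto simp: L2_def)
  show "(\<lambda>x. u x * v x) \<in> borel_measurable M"
    using assms by (auto simp: L2_def)
  have "\<bar>u x * v x\<bar> \<le> (u x)\<^sup>2 + (v x)\<^sup>2" for x
  proof -
    have "2 * \<bar>u x * v x\<bar> \<le> (u x)\<^sup>2 + (v x)\<^sup>2"
      using sum_squares_bound[of "\<bar>u x\<bar>" "\<bar>v x\<bar>"] by (simp add: abs_mult mult.assoc)
    then show ?thesis using abs_ge_zero[of "u x * v x"] by linarith
  qed
  then show "AE x in M. norm (u x * v x) \<le> norm ((u x)\<^sup>2 + (v x)\<^sup>2)"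
    by auto
qed

lemma L2_add:
  assumes "u \<in> L2 M" "v \<in> L2 M"
  shows "(\<lambda>x. u x + v x) \<in> L2 M"
proof -
  have "(\<lambda>x. (u x + v x)\<^sup>2) = (\<lambda>x. (u x)\<^sup>2 + (v x)\<^sup>2 + 2 * (u x * v x))"
    by (simp add: power2_sum mult.assoc)
  then show ?thesis
    using assms L2_mult_integrable[OF assms] by (auto simp: L2_def)
qed

lemma L2_cmult: "u \<in> L2 M \<Longrightarrow> (\<lambda>x. c * u x) \<in> L2 M"
  by (auto simp: L2_def power_mult_distrib)

lemma L2_diff:
  assumes "u \<in> L2 M" "v \<in> L2 M"
  shows "(\<lambda>x. u x - v x) \<in> L2 M"
  using L2_add[OF assms(1) L2_cmult[OF assms(2), of "-1"]] by simp

lemma L2_bound: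
  assumes "v \<in> borel_measurable M" "g \<in> L2 M" "\<And>x. x \<in> space M \<Longrightarrow> \<bar>v x\<bar> \<le> \<bar>g x\<bar>"
  shows "v \<in> L2 M"
proof -
  have "integrable M (\<lambda>x. (v x)\<^sup>2)"
  proof (rule Bochner_Integration.integrable_bound)
    show "integrable M (\<lambda>x. (g x)\<^sup>2)" using assms by (auto simp: L2_def)
    show "AE x in M. norm ((v x)\<^sup>2) \<le> norm ((g x)\<^sup>2)"
    proof (rule AE_I2)
      fix x assume "x \<in> space M"
      then have "(v x)\<^sup>2 \<le> (g x)\<^sup>2" using assms(3) abs_le_square_iff by blast
      then show "norm ((v x)\<^sup>2) \<le> norm ((g x)\<^sup>2)" by simp
    qed
  qed (use assms in auto)
  then show ?thesis using assms(1) by (simp add: L2_def)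
qed

lemma L2_const: "(\<lambda>x. c) \<in> L2 M"
  by (simp add: L2_def)

lemma L2_bounded:
  assumes "v \<in> borel_measurable M" and "\<And>x. x \<in> space M \<Longrightarrow> \<bar>v x\<bar> \<le> B"
  shows "v \<in> L2 M"
  using assms(1) L2_const[of B]
proof (rule L2_bound)
  show "\<bar>v x\<bar> \<le> \<bar>B\<bar>" if "x \<in> space M" for x
    using assms(2)[OF that] by linarith
qed

text \<open>
  This takes the place of Minkowski's inequality: all estimates below are for squared norms, and the
  factor \<open>2\<close> does no harm in the limit.
\<close>

lemma integral_square_add_le:
  assumes "u \<in> L2 M" "v \<in> L2 M"
  shows "(LINT x|M. (u x + v x)\<^sup>2) \<le> 2 * (LINT x|M. (u x)\<^sup>2) + 2 * (LINT x|M. (v x)\<^sup>2)"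
proof -
  have "(LINT x|M. (u x + v x)\<^sup>2) \<le> (LINT x|M. 2 * (u x)\<^sup>2 + 2 * (v x)\<^sup>2)"
  proof (rule integral_mono)
    show "(u x + v x)\<^sup>2 \<le> 2 * (u x)\<^sup>2 + 2 * (v x)\<^sup>2" for x
      using zero_le_power2[of "u x - v x"] by (simp add: power2_eq_square algebra_simps)
  qed (use assms L2_add[OF assms] in \<open>auto simp: L2_def\<close>)
  also have "\<dots> = 2 * (LINT x|M. (u x)\<^sup>2) + 2 * (LINT x|M. (v x)\<^sup>2)"
    using assms by (subst Bochner_Integration.integral_add) (auto simp: L2_def)
  finally show ?thesis .
qed

text \<open>
  Both come from expanding \<open>\<integral> (u - t)\<^sup>2\<close> at the mean \<open>t\<close> of \<open>u\<close>: removing the mean only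
  decreases the norm, and the square that remains is nonnegative.  If the measure is zero, then the
  mean is \<open>0\<close> by the convention for division.
\<close>

lemma
  assumes "u \<in> L2 M"
  shows integral_square_centered_le: "(LINT x|M. (u x - (LINT y|M. u y) / measure M (space M))\<^sup>2) \<le> (LINT x|M. (u x)\<^sup>2)"
    and square_integral_le: "(LINT x|M. u x)\<^sup>2 \<le> measure M (space M) * (LINT x|M. (u x)\<^sup>2)"
proof -
  define w where "w = measure M (space M)"
  define I where "I = (LINT x|M. u x)"
  note [simp] = L2_integrable[OF assms]
  have [simp]: "integrable M (\<lambda>x. (u x)\<^sup>2)" using assms by (auto simp: L2_def)
  have expand: "(LINT x|M. (u x - t)\<^sup>2) = (LINT x|M. (u x)\<^sup>2) - 2 * t * I + t\<^sup>2 * w" for t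
  proof -
    have "(LINT x|M. (u x - t)\<^sup>2) = (LINT x|M. (u x)\<^sup>2 - (2 * t) * u x + t\<^sup>2)"
      by (rule Bochner_Integration.integral_cong) (auto simp: power2_eq_square algebra_simps)
    also have "\<dots> = (LINT x|M. (u x)\<^sup>2) - 2 * t * I + t\<^sup>2 * w"
      by (simp add: I_def w_def)
    finally show ?thesis .
  qed
  have w0: "w \<ge> 0" by (simp add: w_def)
  have I0: "I = 0" if "w = 0"
  proof -
    have "AE x in M. u x = 0"
      using that emeasure_eq_measure[of "space M"] unfolding w_def by (auto intro: AE_I[of _ _ "space M"])
    then show ?thesis unfolding I_def by (simp add: integral_eq_zero_AE)
  qed
  show "(LINT x|M. (u x - (LINT y|M. u y) / measure M (space M))\<^sup>2) \<le> (LINT x|M. (u x)\<^sup>2)"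
    using expand[of "I / w"] w0 I0 unfolding I_def[symmetric] w_def[symmetric]
    by (cases "w = 0") (auto simp: power2_eq_square divide_simps)
  have "0 \<le> (LINT x|M. (u x - I / w)\<^sup>2)" by simp
  then show "(LINT x|M. u x)\<^sup>2 \<le> measure M (space M) * (LINT x|M. (u x)\<^sup>2)"
    unfolding expand[of "I / w"] I_def[symmetric] w_def[symmetric] using w0 I0
    by (cases "w = 0") (auto simp: power2_eq_square field_simps)
qed

lemma L1_le_L2:
  assumes "u \<in> L2 M"
  shows "(LINT x|M. \<bar>u x\<bar>) \<le> sqrt (measure M (space M) * (LINT x|M. (u x)\<^sup>2))"
proof -
  have "(\<lambda>x. \<bar>u x\<bar>) \<in> L2 M"
    using assms by (auto simp: L2_def)
  from square_integral_le[OF this] show ?thesis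
    by (intro real_le_rsqrt) simp
qed

text \<open>
  Cauchy in $L^2$ implies Cauchy in $L^1$ as the measure is finite, so a subsequence converges almost
  everywhere.  Fatou's lemma bounds the $L^2$ distance to the pointwise limit.
\<close>

lemma L2_complete:
  assumes u: "\<And>n. u n \<in> L2 M"
    and Cauchy: "\<And>e. e > 0 \<Longrightarrow> \<exists>N. \<forall>m\<ge>N. \<forall>n\<ge>N. (LINT x|M. (u m x - u n x)\<^sup>2) < e"
  shows "\<exists>F\<in>L2 M. (\<lambda>n. LINT x|M. (u n x - F x)\<^sup>2) \<longlonglongrightarrow> 0"
proof -
  define w where "w = measure M (space M)"
  have [measurable]: "u n \<in> borel_measurable M" for n using u by (auto simp: L2_def)
  have w0: "w \<ge> 0" by (simp add: w_def)
  obtain r where r: "strict_mono r" and AE: "AE x in M. Cauchy (\<lambda>i. u (r i) x)"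
  proof (rule cauchy_L1_AE_cauchy_subseq[of M u])
    show "integrable M (u n)" for n by (rule L2_integrable[OF u])
    fix e :: real assume e: "e > 0"
    obtain N where N: "\<And>m n. m \<ge> N \<Longrightarrow> n \<ge> N \<Longrightarrow> (LINT x|M. (u m x - u n x)\<^sup>2) < e\<^sup>2 / (w + 1)"
      using Cauchy[of "e\<^sup>2 / (w + 1)"] e w0 by auto
    have "(LINT x|M. norm (u i x - u j x)) < e" if "i \<ge> N" "j \<ge> N" for i j
    proof -
      have "(LINT x|M. \<bar>u i x - u j x\<bar>) \<le> sqrt (w * (LINT x|M. (u i x - u j x)\<^sup>2))"
        unfolding w_def by (rule L1_le_L2[OF L2_diff[OF u u]])
      also have "\<dots> \<le> sqrt (w * (e\<^sup>2 / (w + 1)))"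
        using N[OF that] w0 by (intro real_sqrt_le_mono mult_left_mono) auto
      also have "\<dots> < sqrt (e\<^sup>2)"
        using e w0 by (intro real_sqrt_less_mono) (simp add: field_simps)
      finally show ?thesis using e by simp
    qed
    then show "\<exists>N. \<forall>i\<ge>N. \<forall>j\<ge>N. (LINT x|M. norm (u i x - u j x)) < e" by blast
  qed blast
  define F where "F x = lim (\<lambda>i. u (r i) x)" for x
  have [measurable]: "F \<in> borel_measurable M" unfolding F_def by measurable
  have conv: "AE x in M. (\<lambda>i. u (r i) x) \<longlonglongrightarrow> F x"
    using AE by eventually_elim (simp add: F_def convergent_LIMSEQ_iff[symmetric] Cauchy_convergent_iff)
  have Fatou: "integrable M (\<lambda>x. (u n x - F x)\<^sup>2) \<and> (LINT x|M. (u n x - F x)\<^sup>2) \<le> e"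
    if e: "e \<ge> 0" and le: "\<And>m. m \<ge> N \<Longrightarrow> (LINT x|M. (u n x - u m x)\<^sup>2) \<le> e" for e N n
  proof -
    have "(\<integral>\<^sup>+x. ennreal ((u n x - F x)\<^sup>2) \<partial>M) = (\<integral>\<^sup>+x. liminf (\<lambda>i. ennreal ((u n x - u (r i) x)\<^sup>2)) \<partial>M)"
    proof (rule nn_integral_cong_AE, use conv in eventually_elim)
      case (elim x)
      then have "(\<lambda>i. ennreal ((u n x - u (r i) x)\<^sup>2)) \<longlonglongrightarrow> ennreal ((u n x - F x)\<^sup>2)"
        by (intro tendsto_intros)
      then show ?case using lim_imp_Liminf[OF sequentially_bot] by metis
    qed
    also have "\<dots> \<le> liminf (\<lambda>i. \<integral>\<^sup>+x. ennreal ((u n x - u (r i) x)\<^sup>2) \<partial>M)"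
      by (rule nn_integral_liminf) measurable
    also have "\<dots> \<le> ennreal e"
    proof (rule Liminf_le)
      show "\<forall>\<^sub>F i in sequentially. (\<integral>\<^sup>+x. ennreal ((u n x - u (r i) x)\<^sup>2) \<partial>M) \<le> ennreal e"
      proof (rule eventually_sequentiallyI)
        fix i assume "N \<le> i"
        then have "N \<le> r i" using seq_suble[OF r, of i] by simp
        then show "(\<integral>\<^sup>+x. ennreal ((u n x - u (r i) x)\<^sup>2) \<partial>M) \<le> ennreal e"
          using L2_diff[OF u[of n] u[of "r i"]] le[of "r i"]
          by (subst nn_integral_eq_integral) (auto simp: L2_def ennreal_leI)
      qed
    qed simp
    finally have le: "(\<integral>\<^sup>+x. ennreal ((u n x - F x)\<^sup>2) \<partial>M) \<le> ennreal e" .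
    then have int: "integrable M (\<lambda>x. (u n x - F x)\<^sup>2)"
      by (intro integrableI_bounded) (simp_all add: le_less_trans[OF _ ennreal_less_top])
    with le e show ?thesis
      by (subst (asm) nn_integral_eq_integral) auto
  qed
  obtain N1 where N1: "\<And>m n. m \<ge> N1 \<Longrightarrow> n \<ge> N1 \<Longrightarrow> (LINT x|M. (u m x - u n x)\<^sup>2) < 1"
    using Cauchy[of 1] by auto
  have "(\<lambda>x. u N1 x - F x) \<in> L2 M"
    using Fatou[of 1 N1 N1] N1 by (auto simp: L2_def less_imp_le)
  from L2_diff[OF u[of N1] this] have F: "F \<in> L2 M" by simp
  have "(\<lambda>n. LINT x|M. (u n x - F x)\<^sup>2) \<longlonglongrightarrow> 0"
  proof (rule LIMSEQ_I)
    fix e :: real assume e: "e > 0"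
    obtain N where N: "\<And>m n. m \<ge> N \<Longrightarrow> n \<ge> N \<Longrightarrow> (LINT x|M. (u m x - u n x)\<^sup>2) < e/2"
      using Cauchy[of "e/2"] e by auto
    have "norm ((LINT x|M. (u n x - F x)\<^sup>2) - 0) < e" if n: "n \<ge> N" for n
    proof -
      have "(LINT x|M. (u n x - F x)\<^sup>2) \<le> e/2"
        using Fatou[of "e/2" N n] N[OF n] e by (simp add: less_imp_le)
      then show ?thesis using e by simp
    qed
    then show "\<exists>N. \<forall>n\<ge>N. norm ((LINT x|M. (u n x - F x)\<^sup>2) - 0) < e"
      by blast
  qed
  with F show ?thesis by blast
qed

end

text \<open>
  The rays generate the Borel sets and are stable under intersection, so the indicators in the class
  form a Dynkin system that is everything.  Linear combinations then give all simple functions, and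
  every \<open>F\<close> is a limit of simple functions dominated by \<open>2 * \<bar>F\<bar>\<close>.  Dominated
  pointwise convergence, instead of convergence in norm, makes the closure condition easy to check
  by the dominated convergence theorem.
\<close>

lemma L2_induct [consumes 3, case_names ray add cmult lim]:
  fixes P :: "(real \<Rightarrow> real) \<Rightarrow> bool" and M :: "real measure"
  assumes fin: "finite_measure M" and sets_M: "sets M = sets (restrict_space borel S)"
    and F: "F \<in> L2 M"
    and ray: "\<And>x. P (indicator {..x})"
    and add: "\<And>u v. P u \<Longrightarrow> P v \<Longrightarrow> P (\<lambda>x. u x + v x)"
    and cmult: "\<And>c u. P u \<Longrightarrow> P (\<lambda>x. c * u x)"
    and lim: "\<And>u v g. (\<And>n. P (u n)) \<Longrightarrow> g \<in> L2 M \<Longrightarrow> (\<And>n x. x \<in> space M \<Longrightarrow> \<bar>u n x\<bar> \<le> g x) \<Longrightarrow>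
        (\<And>x. x \<in> space M \<Longrightarrow> (\<lambda>n. u n x) \<longlonglongrightarrow> v x) \<Longrightarrow> P v"
  shows "P F"
proof -
  interpret finite_line_measure M using fin by (simp add: finite_line_measure_def)
  have space_M: "space M = S"
    using sets_eq_imp_space_eq[OF sets_M] by (simp add: space_restrict_space)
  have zero: "P (\<lambda>x. 0)" using cmult[OF ray[of 0], of 0] by simp
  have sum: "P (\<lambda>x. \<Sum>i\<in>I. v i x)" if "finite I" "\<And>i. i \<in> I \<Longrightarrow> P (v i)" for I :: "'i set" and v
    using that by (induction I) (auto simp: zero intro: add)
  have one: "P (\<lambda>x. 1)"
  proof (rule lim[of "\<lambda>n. indicator {..real n}" "\<lambda>x. 1"])
    fix x :: real
    have "\<forall>\<^sub>F n in sequentially. x \<le> real n"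
      by (metis eventually_sequentiallyI nat_ceiling_le_eq)
    then show "(\<lambda>n. indicator {..real n} x :: real) \<longlonglongrightarrow> 1"
      by (intro tendsto_eventually) (auto elim!: eventually_mono)
  qed (auto simp: ray L2_const indicator_def)
  have ind: "P (indicator A)" if "A \<in> sets borel" for A :: "real set"
  proof -
    have "{..a} \<inter> {..b} = {..min a b}" for a b :: real by auto
    then have "Int_stable (range (\<lambda>x::real. {..x}))"
      by (auto simp: Int_stable_def)
    moreover have "range (\<lambda>x::real. {..x}) \<subseteq> Pow UNIV" by simp
    moreover have "A \<in> sigma_sets UNIV (range (\<lambda>x::real. {..x}))"
      using that by (simp add: borel_eq_atMost)
    ultimately show ?thesis
    proof (induction rule: sigma_sets_induct_disjoint)
      case (basic A) then show ?case using ray by auto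
    next
      case empty then show ?case using zero by (simp add: indicator_def[abs_def])
    next
      case (compl A)
      then have "P (\<lambda>x. 1 + (- 1) * indicator A x)" by (intro add one cmult)
      moreover have "(\<lambda>x. 1 + (- 1) * indicator A x) = (indicator (UNIV - A) :: real \<Rightarrow> real)"
        by (auto simp: indicator_def)
      ultimately show ?case by simp
    next
      case (union A)
      show ?case
      proof (rule lim[of "\<lambda>n x. \<Sum>i<n. indicator (A i) x" "\<lambda>x. 1"])
        have eq: "(\<Sum>i<n. indicator (A i) x) = (indicator (\<Union>i<n. A i) x :: real)" for n x
          using union(1) by (subst indicator_UN_disjoint) (auto simp: disjoint_family_on_def)
        show "P (\<lambda>x. \<Sum>i<n. indicator (A i) x)" for n
          by (rule sum) (auto intro: union)
        show "\<bar>\<Sum>i<n. indicator (A i) x\<bar> \<le> (1::real)" for n x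
          unfolding eq by (simp add: indicator_def)
        show "(\<lambda>n. \<Sum>i<n. indicator (A i) x) \<longlonglongrightarrow> (indicator (\<Union>(range A)) x :: real)" for x
          unfolding eq by (rule LIMSEQ_indicator_UN)
      qed (rule L2_const)
    qed
  qed
  have F_meas: "F \<in> borel_measurable M" using F by (simp add: L2_def)
  obtain s where s: "\<And>i. simple_function M (s i)" "\<And>x. x \<in> space M \<Longrightarrow> (\<lambda>i. s i x) \<longlonglongrightarrow> F x"
    "\<And>i x. x \<in> space M \<Longrightarrow> \<bar>s i x\<bar> \<le> 2 * \<bar>F x\<bar>"
    using borel_measurable_implies_sequence_metric[OF F_meas, of 0] by (simp add: dist_real_def) blast
  have "\<exists>B. \<forall>i y. B i y \<in> sets borel \<and> s i -` {y} \<inter> space M = S \<inter> B i y"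
  proof (intro choice allI)
    fix i y
    have "s i -` {y} \<inter> space M \<in> sets M" using simple_functionD(2)[OF s(1)] .
    then show "\<exists>B. B \<in> sets borel \<and> s i -` {y} \<inter> space M = S \<inter> B"
      unfolding sets_M sets_restrict_space by auto
  qed
  then obtain B where B: "\<And>i y. B i y \<in> sets borel" "\<And>i y. s i -` {y} \<inter> space M = S \<inter> B i y"
    by metis
  define t where "t i x = (\<Sum>y\<in>s i ` space M. y * indicator (B i y) x)" for i x
  have t_eq: "t i x = s i x" if "x \<in> space M" for i x
  proof -
    have "x \<in> B i y \<longleftrightarrow> y = s i x" for y
      using B(2)[of i y] that space_M by (auto simp: set_eq_iff)
    then have "t i x = (\<Sum>y\<in>s i ` space M. if y = s i x then y else 0)"
      unfolding t_def by (intro sum.cong refl) (simp add: indicator_def)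
    also have "\<dots> = s i x"
      using that simple_functionD(1)[OF s(1)] by simp
    finally show ?thesis .
  qed
  show ?thesis
  proof (rule lim)
    show "P (t i)" for i
      unfolding t_def[abs_def] using simple_functionD(1)[OF s(1)] 
      by (intro sum cmult ind) (auto simp: B)
    have "(\<lambda>x. \<bar>F x\<bar>) \<in> L2 M" using F by (auto simp: L2_def)
    then show "(\<lambda>x. 2 * \<bar>F x\<bar>) \<in> L2 M" by (rule L2_cmult)
  qed (use s in \<open>auto simp: t_eq\<close>)
qed

section \<open>Cadlag and caglad functions\<close>

lemma continuous_at_right_reflect:
  "continuous (at_right x) (\<lambda>x. f (- x)) \<longleftrightarrow> continuous (at_left (- x)) (f :: real \<Rightarrow> real)"
  by (simp add: continuous_within filterlim_at_left_to_right)

lemma cadlag_reflect: "cadlag (\<lambda>x. f (- x)) \<longleftrightarrow> caglad f"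
  unfolding cadlag_def caglad_def continuous_at_right_reflect
  by (auto simp: filterlim_at_left_to_right[of "\<lambda>x. f (- x)"] all_conj_distrib)
    (metis minus_minus)+

lemma caglad_reflect: "caglad (\<lambda>x. f (- x)) \<longleftrightarrow> cadlag f"
  using cadlag_reflect[of "\<lambda>x. f (- x)"] by simp

lemma cadlag_const: "cadlag (\<lambda>x. c)"
  unfolding cadlag_def by (auto intro: tendsto_const)

lemma cadlag_add:
  assumes "cadlag f" "cadlag g"
  shows "cadlag (\<lambda>x. f x + g x)"
  unfolding cadlag_def
proof (intro allI conjI)
  fix x
  show "continuous (at_right x) (\<lambda>x. f x + g x)"
    using assms by (intro continuous_add) (auto simp: cadlag_def)
  obtain l m where "(f \<longlongrightarrow> l) (at_left x)" "(g \<longlongrightarrow> m) (at_left x)"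
    using assms unfolding cadlag_def by blast
  then show "\<exists>l. ((\<lambda>x. f x + g x) \<longlongrightarrow> l) (at_left x)"
    by (blast intro: tendsto_add)
qed

lemma cadlag_cmult:
  assumes "cadlag f"
  shows "cadlag (\<lambda>x. c * f x)"
  unfolding cadlag_def
proof (intro allI conjI)
  fix x
  show "continuous (at_right x) (\<lambda>x. c * f x)"
    using assms by (intro continuous_mult_left) (auto simp: cadlag_def)
  obtain l where "(f \<longlongrightarrow> l) (at_left x)"
    using assms unfolding cadlag_def by blast
  then show "\<exists>l. ((\<lambda>x. c * f x) \<longlongrightarrow> l) (at_left x)"
    by (blast intro: tendsto_mult_left)
qed

lemma caglad_add: "caglad f \<Longrightarrow> caglad g \<Longrightarrow> caglad (\<lambda>x. f x + g x)"
  using cadlag_add[of "\<lambda>x. f (- x)" "\<lambda>x. g (- x)"] cadlag_reflect[of "\<lambda>x. f x + g x"]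
  by (simp add: cadlag_reflect)

lemma caglad_cmult: "caglad f \<Longrightarrow> caglad (\<lambda>x. c * f x)"
  using cadlag_cmult[of "\<lambda>x. f (- x)"] cadlag_reflect[of "\<lambda>x. c * f x"]
  by (simp add: cadlag_reflect)

lemma caglad_const: "caglad (\<lambda>x. c)"
  unfolding caglad_def by (auto intro: tendsto_const)

lemma cadlag_bounded_on_interval:
  assumes f: "cadlag f" and "a \<le> b"
  shows "\<exists>B. \<forall>x\<in>{a..b}. \<bar>f x\<bar> \<le> B"
  using \<open>a \<le> b\<close>
proof (induction rule: Bolzano)
  case (trans a b c)
  then obtain B C where "\<forall>x\<in>{a..b}. \<bar>f x\<bar> \<le> B" "\<forall>x\<in>{b..c}. \<bar>f x\<bar> \<le> C" by blast
  then show ?case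
    by (intro exI[of _ "max B C"]) (metis atLeastAtMost_iff le_max_iff_disj linear)
next
  case (local x)
  obtain l where l: "(f \<longlongrightarrow> l) (at_left x)" and r: "(f \<longlongrightarrow> f x) (at_right x)"
    using f by (auto simp: cadlag_def continuous_within)
  have "\<forall>\<^sub>F y in at_left x. \<bar>f y - l\<bar> < 1" "\<forall>\<^sub>F y in at_right x. \<bar>f y - f x\<bar> < 1"
    using tendstoD[OF l, of 1] tendstoD[OF r, of 1] by (simp_all add: dist_real_def)
  then obtain c d where c: "c < x" "\<And>y. c < y \<Longrightarrow> y < x \<Longrightarrow> \<bar>f y - l\<bar> < 1"
    and d: "d > x" "\<And>y. x < y \<Longrightarrow> y < d \<Longrightarrow> \<bar>f y - f x\<bar> < 1"
    unfolding eventually_at_left_field eventually_at_right_field by blast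
  have bound: "\<bar>f y\<bar> \<le> max \<bar>l\<bar> \<bar>f x\<bar> + 1" if "c < y" "y < d" for y
    using c(2)[of y] d(2)[of y] that by (cases y x rule: linorder_cases) auto
  show ?case
  proof (rule exI[of _ "min (x - c) (d - x)"], intro conjI allI impI)
    show "\<exists>B. \<forall>y\<in>{a'..b'}. \<bar>f y\<bar> \<le> B"
      if "a' \<le> x \<and> x \<le> b' \<and> b' - a' < min (x - c) (d - x)" for a' b'
      using that by (intro exI[of _ "max \<bar>l\<bar> \<bar>f x\<bar> + 1"] ballI bound) auto
  qed (use c d in auto)
qed

text \<open>
  By right continuity \<open>f\<close> is the limit of its values at the next point of the grid of mesh
  \<open>1 / (n + 1)\<close> strictly to the right; each approximation depends on \<open>x\<close> only through an integer.
\<close>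

lemma cadlag_measurable:
  assumes f: "cadlag f"
  shows "f \<in> borel_measurable borel"
proof -
  let ?y = "\<lambda>n x. (of_int \<lfloor>(real n + 1) * x\<rfloor> + 1) / (real n + 1)"
  have gt: "x < ?y n x" for n x
    using floor_correct[of "(real n + 1) * x"] by (simp add: field_simps)
  have le: "?y n x \<le> x + 1 / (real n + 1)" for n x
  proof -
    have "of_int \<lfloor>(real n + 1) * x\<rfloor> / (real n + 1) \<le> x"
      by (subst divide_le_eq) (auto simp: mult.commute)
    then show ?thesis by (simp add: add_divide_distrib)
  qed
  have lim: "(\<lambda>n. ?y n x) \<longlonglongrightarrow> x" for x
  proof (rule tendsto_sandwich)
    show "(\<lambda>n. x) \<longlonglongrightarrow> x" by simp
    have "(\<lambda>n. x + 1 / (real n + 1)) \<longlonglongrightarrow> x + 0"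
      using LIMSEQ_inverse_real_of_nat by (intro tendsto_intros) (simp add: inverse_eq_divide add.commute)
    then show "(\<lambda>n. x + 1 / (real n + 1)) \<longlonglongrightarrow> x" by simp
  qed (use gt le in \<open>auto intro: less_imp_le always_eventually\<close>)
  have lim_f: "(\<lambda>n. f (?y n x)) \<longlonglongrightarrow> f x" for x
  proof (rule filterlim_compose[where g = f])
    show "(f \<longlongrightarrow> f x) (at_right x)"
      using f by (simp add: cadlag_def continuous_within)
    show "filterlim (\<lambda>n. ?y n x) (at_right x) sequentially"
      unfolding filterlim_at using lim by (simp add: gt less_imp_neq[OF gt, symmetric])
  qed
  have "(\<lambda>x. f (?y n x)) \<in> borel_measurable borel" for n
  proof -
    have "(\<lambda>k::int. f ((of_int k + 1) / (real n + 1))) \<in> borel_measurable (count_space UNIV)"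
      by simp
    moreover have "(\<lambda>x. \<lfloor>(real n + 1) * x\<rfloor>) \<in> borel \<rightarrow>\<^sub>M count_space UNIV"
      by measurable
    ultimately show ?thesis by (rule measurable_compose_rev)
  qed
  then show ?thesis by (rule borel_measurable_LIMSEQ_real[OF lim_f])
qed

lemma caglad_measurable:
  assumes "caglad f"
  shows "f \<in> borel_measurable borel"
proof -
  have "(\<lambda>x. f (- x)) \<in> borel_measurable borel"
    using assms by (intro cadlag_measurable) (simp add: cadlag_reflect)
  from measurable_compose[OF borel_measurable_uminus[OF measurable_ident] this]
  show ?thesis by simp
qed

lemma periodic1_eq_frac: "periodic1 f \<Longrightarrow> f (frac x) = f x"
proof -
  assume per: "periodic1 f"
  have nat: "f (y + real n) = f y" for y n
  proof (induction n)
    case (Suc n)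
    have "f (y + real (Suc n)) = f ((y + real n) + 1)" by (simp add: algebra_simps)
    then show ?case using Suc per by (simp add: periodic1_def)
  qed simp
  have "f (y + of_int k) = f y" for y k
  proof (cases "k \<ge> 0")
    case True then show ?thesis using nat[of y "nat k"] by simp
  next
    case False then show ?thesis using nat[of "y + of_int k" "nat (- k)"] by simp
  qed
  from this[of "frac x" "\<lfloor>x\<rfloor>"] show ?thesis by (simp add: frac_def)
qed

lemma cadlag_periodic_bounded:
  assumes "cadlag f" "periodic1 f"
  shows "\<exists>B. \<forall>x. \<bar>f x\<bar> \<le> B"
proof -
  obtain B where "\<forall>x\<in>{0..1}. \<bar>f x\<bar> \<le> B"
    using cadlag_bounded_on_interval[OF assms(1), of 0 1] by auto
  then have "\<bar>f (frac x)\<bar> \<le> B" for x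
    by (simp add: frac_lt_1 less_imp_le)
  then show ?thesis using periodic1_eq_frac[OF assms(2)] by metis
qed

lemma periodic1_reflect: "periodic1 f \<Longrightarrow> periodic1 (\<lambda>x. f (- x))"
  unfolding periodic1_def by (metis add.commute add_diff_cancel_left' diff_minus_eq_add minus_add_distrib minus_diff_commute)

lemma caglad_periodic_bounded:
  assumes "caglad f" "periodic1 f"
  shows "\<exists>B. \<forall>x. \<bar>f x\<bar> \<le> B"
  using cadlag_periodic_bounded[of "\<lambda>x. f (- x)"] assms cadlag_reflect periodic1_reflect
  by (metis minus_minus)

lemma frac_at_right: "\<forall>\<^sub>F y in at_right x. frac y = y - of_int \<lfloor>x\<rfloor>" for x :: real
proof -
  have "\<forall>\<^sub>F y in at_right x. y \<in> {x<..<of_int \<lfloor>x\<rfloor> + 1}"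
    by (rule eventually_at_right_real) linarith
  then show ?thesis
  proof eventually_elim
    case (elim y)
    then have "\<lfloor>y\<rfloor> = \<lfloor>x\<rfloor>" by (simp add: floor_eq_iff) linarith
    then show ?case by (simp add: frac_def)
  qed
qed

lemma frac_at_left: "\<forall>\<^sub>F y in at_left x. frac y = y - (of_int \<lceil>x\<rceil> - 1)" for x :: real
proof -
  have "\<forall>\<^sub>F y in at_left x. y \<in> {of_int \<lceil>x\<rceil> - 1<..<x}"
    by (rule eventually_at_left_real) linarith
  then show ?thesis
  proof eventually_elim
    case (elim y)
    then have "\<lfloor>y\<rfloor> = \<lceil>x\<rceil> - 1" by (simp add: floor_eq_iff) linarith
    then show ?case by (simp add: frac_def)
  qed
qed

lemma filterlim_shift_at_right: "filterlim (\<lambda>y. y - c) (at_right (x - c)) (at_right x)" for c x :: real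
  using filtermap_at_right_shift[of c x] by (simp add: filterlim_def)

lemma filterlim_shift_at_left: "filterlim (\<lambda>y. y - c) (at_left (x - c)) (at_left x)" for c x :: real
  unfolding filterlim_at by (auto intro!: tendsto_eq_intros simp: eventually_at_filter)

lemma cadlag_periodize:
  assumes k: "cadlag k"
  shows "cadlag (\<lambda>x. k (frac x))"
  unfolding cadlag_def
proof (intro allI conjI)
  fix x :: real
  have "(k \<longlongrightarrow> k (frac x)) (at_right (x - of_int \<lfloor>x\<rfloor>))"
    using k by (simp add: cadlag_def continuous_within frac_def)
  then have "((\<lambda>y. k (y - of_int \<lfloor>x\<rfloor>)) \<longlongrightarrow> k (frac x)) (at_right x)"
    using filterlim_compose filterlim_shift_at_right by blast
  then show "continuous (at_right x) (\<lambda>x. k (frac x))"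
    unfolding continuous_within
    by (rule Lim_transform_eventually) (use frac_at_right[of x] in \<open>auto elim: eventually_mono\<close>)
  obtain l where "(k \<longlongrightarrow> l) (at_left (x - (of_int \<lceil>x\<rceil> - 1)))"
    using k by (auto simp: cadlag_def)
  then have "((\<lambda>y. k (y - (of_int \<lceil>x\<rceil> - 1))) \<longlongrightarrow> l) (at_left x)"
    using filterlim_compose filterlim_shift_at_left by blast
  then have "((\<lambda>x. k (frac x)) \<longlongrightarrow> l) (at_left x)"
    by (rule Lim_transform_eventually) (use frac_at_left[of x] in \<open>auto elim: eventually_mono\<close>)
  then show "\<exists>l. ((\<lambda>x. k (frac x)) \<longlongrightarrow> l) (at_left x)" ..
qed

lemma cadlag_indicator_Ici: "cadlag (indicator {a..})" for a :: real
  unfolding cadlag_def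
proof (intro allI conjI)
  fix x :: real
  have "\<forall>\<^sub>F y in at_right x. indicator {a..} y = (indicator {a..} x :: real)"
  proof (cases "x < a")
    case True
    show ?thesis using eventually_at_right_real[OF True] by (rule eventually_mono) (auto simp: indicator_def)
  next
    case False
    then show ?thesis by (auto simp: eventually_at_filter indicator_def)
  qed
  then show "continuous (at_right x) (indicator {a..} :: real \<Rightarrow> real)"
    unfolding continuous_within by (rule tendsto_eventually)
  show "\<exists>l. ((indicator {a..} :: real \<Rightarrow> real) \<longlongrightarrow> l) (at_left x)"
  proof (cases "a < x")
    case True
    have "\<forall>\<^sub>F y in at_left x. indicator {a..} y = (1 :: real)"
      using eventually_at_left_real[OF True] by (rule eventually_mono) (auto simp: indicator_def)
    then show ?thesis by (intro exI tendsto_eventually)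
  next
    case False
    have "\<forall>\<^sub>F y in at_left x. indicator {a..} y = (0 :: real)"
      using False by (auto simp: eventually_at_filter indicator_def)
    then show ?thesis by (intro exI tendsto_eventually)
  qed
qed

section \<open>Differentiation and integration with respect to an increasing function\<close>

lemma filterlim_at_left_0_shift:
  "filterlim (\<lambda>h. q (x + h)) F (at_left 0) \<longleftrightarrow> filterlim q F (at_left (x :: real))"
  by (simp add: filterlim_at_left_to_right[of _ _ x] filterlim_at_left_to_right[of _ _ 0]
      filterlim_at_right_to_0[of _ _ "- x"])

lemma filterlim_at_right_0_shift:
  "filterlim (\<lambda>h. q (x + h)) F (at_right 0) \<longleftrightarrow> filterlim q F (at_right (x :: real))"
  by (simp add: filterlim_at_right_to_0[of _ _ x] add.commute)

text \<open>
  Relational forms of \<^const>\<open>D_left\<close> and \<^const>\<open>D_right\<close>, so that differentiability and the value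
  of the derivative are one statement, about a limit at \<open>x\<close> rather than at increment \<open>0\<close>.
\<close>

definition has_left_deriv :: "(real \<Rightarrow> real) \<Rightarrow> (real \<Rightarrow> real) \<Rightarrow> (real \<Rightarrow> real) \<Rightarrow> bool" where
  "has_left_deriv W f g \<longleftrightarrow> (\<forall>x. ((\<lambda>y. (f y - f x) / (W y - W x)) \<longlongrightarrow> g x) (at_left x))"

definition has_right_deriv :: "(real \<Rightarrow> real) \<Rightarrow> (real \<Rightarrow> real) \<Rightarrow> (real \<Rightarrow> real) \<Rightarrow> bool" where
  "has_right_deriv V g k \<longleftrightarrow> (\<forall>x. ((\<lambda>y. (g y - g x) / (V y - V x)) \<longlongrightarrow> k x) (at_right x))"

lemma has_left_deriv_iff:
  "has_left_deriv W f g \<longleftrightarrow> W_left_differentiable W f \<and> D_left W f = g"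
proof -
  have eq: "((\<lambda>h. (f (x + h) - f x) / (W (x + h) - W x)) \<longlongrightarrow> l) (at_left 0) \<longleftrightarrow>
      ((\<lambda>y. (f y - f x) / (W y - W x)) \<longlongrightarrow> l) (at_left x)" for x l
    by (rule filterlim_at_left_0_shift)
  have lim: "D_left W f x = l" if "((\<lambda>y. (f y - f x) / (W y - W x)) \<longlongrightarrow> l) (at_left x)" for x l
    unfolding D_left_def using that by (intro tendsto_Lim) (simp_all add: eq)
  show ?thesis
  proof (intro iffI conjI ext)
    assume "has_left_deriv W f g"
    then have conv: "((\<lambda>y. (f y - f x) / (W y - W x)) \<longlongrightarrow> g x) (at_left x)" for x
      by (simp add: has_left_deriv_def)
    then show "W_left_differentiable W f" unfolding W_left_differentiable_def eq by blast
    show "D_left W f x = g x" for x by (rule lim[OF conv])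
  next
    assume R: "W_left_differentiable W f \<and> D_left W f = g"
    show "has_left_deriv W f g"
      unfolding has_left_deriv_def
    proof
      fix x
      obtain l where l: "((\<lambda>y. (f y - f x) / (W y - W x)) \<longlongrightarrow> l) (at_left x)"
        using R unfolding W_left_differentiable_def eq by blast
      with R lim[OF l] show "((\<lambda>y. (f y - f x) / (W y - W x)) \<longlongrightarrow> g x) (at_left x)"
        by simp
    qed
  qed
qed

lemma has_right_deriv_iff:
  "has_right_deriv V g k \<longleftrightarrow> V_right_differentiable V g \<and> D_right V g = k"
proof -
  have eq: "((\<lambda>h. (g (x + h) - g x) / (V (x + h) - V x)) \<longlongrightarrow> l) (at_right 0) \<longleftrightarrow>
      ((\<lambda>y. (g y - g x) / (V y - V x)) \<longlongrightarrow> l) (at_right x)" for x l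
    by (rule filterlim_at_right_0_shift)
  have lim: "D_right V g x = l" if "((\<lambda>y. (g y - g x) / (V y - V x)) \<longlongrightarrow> l) (at_right x)" for x l
    unfolding D_right_def using that by (intro tendsto_Lim) (simp_all add: eq)
  show ?thesis
  proof (intro iffI conjI ext)
    assume "has_right_deriv V g k"
    then have conv: "((\<lambda>y. (g y - g x) / (V y - V x)) \<longlongrightarrow> k x) (at_right x)" for x
      by (simp add: has_right_deriv_def)
    then show "V_right_differentiable V g" unfolding V_right_differentiable_def eq by blast
    show "D_right V g x = k x" for x by (rule lim[OF conv])
  next
    assume R: "V_right_differentiable V g \<and> D_right V g = k"
    show "has_right_deriv V g k"
      unfolding has_right_deriv_def
    proof
      fix x
      obtain l where l: "((\<lambda>y. (g y - g x) / (V y - V x)) \<longlongrightarrow> l) (at_right x)"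
        using R unfolding V_right_differentiable_def eq by blast
      with R lim[OF l] show "((\<lambda>y. (g y - g x) / (V y - V x)) \<longlongrightarrow> k x) (at_right x)"
        by simp
    qed
  qed
qed

text \<open>
  Under \<open>x \<mapsto> - x\<close> the left-continuous \<open>V\<close> becomes the right-continuous \<open>x \<mapsto> - V (- x)\<close>.  All
  facts about right derivatives are obtained from this.
\<close>

lemma has_right_deriv_reflect:
  "has_right_deriv V g k \<longleftrightarrow> has_left_deriv (\<lambda>x. - V (- x)) (\<lambda>x. - g (- x)) (\<lambda>x. k (- x))"
  (is "?L \<longleftrightarrow> ?R")
proof -
  have "((\<lambda>y. (- g (- y) - - g (- x)) / (- V (- y) - - V (- x))) \<longlongrightarrow> l) (at_left x) \<longleftrightarrow>
      ((\<lambda>y. (g y - g (- x)) / (V y - V (- x))) \<longlongrightarrow> l) (at_right (- x))" for x l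
  proof -
    have "(- g (- y) - - g (- x)) / (- V (- y) - - V (- x)) = (g (- y) - g (- x)) / (V (- y) - V (- x))" for y
      by (metis minus_diff_minus minus_divide_divide)
    then show ?thesis by (simp add: filterlim_at_left_to_right)
  qed
  then have "?R \<longleftrightarrow> (\<forall>x. ((\<lambda>y. (g y - g (- x)) / (V y - V (- x))) \<longlongrightarrow> k (- x)) (at_right (- x)))"
    by (simp add: has_left_deriv_def)
  also have "\<dots> \<longleftrightarrow> ?L"
    unfolding has_right_deriv_def 
  proof (intro iffI allI)
    fix x assume "\<forall>x. ((\<lambda>y. (g y - g (- x)) / (V y - V (- x))) \<longlongrightarrow> k (- x)) (at_right (- x))"
    from spec[OF this, of "- x"]
    show "((\<lambda>y. (g y - g x) / (V y - V x)) \<longlongrightarrow> k x) (at_right x)" by simp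
  qed blast
  finally show ?thesis ..
qed

lemma has_left_deriv_add:
  assumes "has_left_deriv W f g" "has_left_deriv W f' g'"
  shows "has_left_deriv W (\<lambda>x. f x + f' x) (\<lambda>x. g x + g' x)"
  unfolding has_left_deriv_def
proof
  fix x
  have "((\<lambda>y. (f y - f x) / (W y - W x) + (f' y - f' x) / (W y - W x)) \<longlongrightarrow> g x + g' x) (at_left x)"
    using assms by (intro tendsto_add) (auto simp: has_left_deriv_def)
  then show "((\<lambda>y. (f y + f' y - (f x + f' x)) / (W y - W x)) \<longlongrightarrow> g x + g' x) (at_left x)"
    by (simp add: add_divide_distrib[symmetric] algebra_simps)
qed

lemma has_left_deriv_cmult:
  assumes "has_left_deriv W f g"
  shows "has_left_deriv W (\<lambda>x. c * f x) (\<lambda>x. c * g x)"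
  unfolding has_left_deriv_def
proof
  fix x
  have "((\<lambda>y. c * ((f y - f x) / (W y - W x))) \<longlongrightarrow> c * g x) (at_left x)"
    using assms by (intro tendsto_mult_left) (auto simp: has_left_deriv_def)
  then show "((\<lambda>y. (c * f y - c * f x) / (W y - W x)) \<longlongrightarrow> c * g x) (at_left x)"
    by (simp add: right_diff_distrib)
qed

lemma has_left_deriv_const: "has_left_deriv W (\<lambda>x. c) (\<lambda>x. 0)"
  by (simp add: has_left_deriv_def)

lemma has_right_deriv_add:
  "has_right_deriv V f g \<Longrightarrow> has_right_deriv V f' g' \<Longrightarrow>
    has_right_deriv V (\<lambda>x. f x + f' x) (\<lambda>x. g x + g' x)"
  unfolding has_right_deriv_reflect by (drule (1) has_left_deriv_add) (simp add: add.commute)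

lemma has_right_deriv_cmult:
  "has_right_deriv V f g \<Longrightarrow> has_right_deriv V (\<lambda>x. c * f x) (\<lambda>x. c * g x)"
  unfolding has_right_deriv_reflect by (drule has_left_deriv_cmult[of _ _ _ c]) simp

lemma has_right_deriv_const: "has_right_deriv V (\<lambda>x. c) (\<lambda>x. 0)"
  by (simp add: has_right_deriv_def)

locale cadlag_clock =
  fixes W :: "real \<Rightarrow> real"
  assumes strict: "strict_mono W" and cadlag: "cadlag W"
begin

abbreviation mu :: "real measure" where "mu \<equiv> interval_measure W"

lemma W_mono: "x \<le> y \<Longrightarrow> W x \<le> W y"
  using strict by (simp add: strict_mono_less_eq)

lemma W_less: "x < y \<Longrightarrow> W x < W y"
  using strict by (simp add: strict_mono_less)

lemma W_right_cont: "continuous (at_right x) W"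
  using cadlag by (simp add: cadlag_def)

lemma emeasure_Ioc: "a \<le> b \<Longrightarrow> emeasure mu {a<..b} = ennreal (W b - W a)"
  by (rule emeasure_interval_measure_Ioc[OF _ W_mono W_right_cont])

lemma measure_Ioc: "a \<le> b \<Longrightarrow> measure mu {a<..b} = W b - W a"
  by (rule measure_interval_measure_Ioc[OF _ W_mono W_right_cont])

text \<open>
  Moving left from \<open>y\<close>, consider how far \<open>\<bar>\<phi> y - \<phi> t\<bar> \<le> e * (W y - W t)\<close> persists.  Right
  continuity of \<open>\<phi>\<close> and \<open>W\<close> carries the estimate to the infimum \<open>s\<close> of the points reached, and the
  vanishing left derivative at \<open>s\<close> carries it beyond \<open>s\<close>.  So it reaches every \<open>x\<close>, for each \<open>e\<close>.
  Jumps of \<open>W\<close> are harmless because the estimate is relative to increments of \<open>W\<close>.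
\<close>

lemma left_deriv_0_imp_constant:
  assumes cont: "\<And>x. continuous (at_right x) \<phi>" and deriv: "has_left_deriv W \<phi> (\<lambda>x. 0)"
  shows "\<phi> x = \<phi> y"
proof -
  have main: "\<bar>\<phi> y - \<phi> x\<bar> \<le> e * (W y - W x)" if "x < y" "e > 0" for x y e
  proof -
    define S where "S = {z \<in> {x..y}. \<forall>t\<in>{z..y}. \<bar>\<phi> y - \<phi> t\<bar> \<le> e * (W y - W t)}"
    define s where "s = Inf S"
    have yS: "y \<in> S" using \<open>x < y\<close> by (auto simp: S_def)
    have bdd: "bdd_below S" by (intro bdd_belowI[of _ x]) (auto simp: S_def)
    have sx: "x \<le> s" unfolding s_def using yS by (intro cInf_greatest) (auto simp: S_def)
    have sy: "s \<le> y" unfolding s_def using yS bdd by (intro cInf_lower)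
    have right: "\<bar>\<phi> y - \<phi> t\<bar> \<le> e * (W y - W t)" if "s < t" "t \<le> y" for t
    proof -
      obtain z where "z \<in> S" "z < t" using \<open>s < t\<close> yS bdd unfolding s_def
        by (metis cInf_less_iff empty_iff)
      then show ?thesis using that by (auto simp: S_def)
    qed
    have at_s: "\<bar>\<phi> y - \<phi> s\<bar> \<le> e * (W y - W s)"
    proof (cases "s < y")
      case True
      have 1: "((\<lambda>t. \<bar>\<phi> y - \<phi> t\<bar>) \<longlongrightarrow> \<bar>\<phi> y - \<phi> s\<bar>) (at_right s)"
        using cont[of s] unfolding continuous_within by (intro tendsto_intros)
      have 2: "((\<lambda>t. e * (W y - W t)) \<longlongrightarrow> e * (W y - W s)) (at_right s)"
        using W_right_cont[of s] unfolding continuous_within by (intro tendsto_intros)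
      have "\<forall>\<^sub>F t in at_right s. \<bar>\<phi> y - \<phi> t\<bar> \<le> e * (W y - W t)"
        using eventually_at_right_real[OF True] by eventually_elim (auto intro: right)
      then show ?thesis by (rule tendsto_le[OF trivial_limit_at_right_real 2 1])
    qed (use sy in auto)
    have "s = x"
    proof (rule ccontr)
      assume "s \<noteq> x"
      then have "x < s" using sx by simp
      have "((\<lambda>t. (\<phi> t - \<phi> s) / (W t - W s)) \<longlongrightarrow> 0) (at_left s)"
        using deriv by (simp add: has_left_deriv_def)
      then have "\<forall>\<^sub>F t in at_left s. \<bar>(\<phi> t - \<phi> s) / (W t - W s)\<bar> < e"
        using \<open>e > 0\<close> by (auto dest: tendstoD simp: dist_real_def)
      then obtain c where c: "c < s" "\<And>t. c < t \<Longrightarrow> t < s \<Longrightarrow> \<bar>(\<phi> t - \<phi> s) / (W t - W s)\<bar> < e"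
        unfolding eventually_at_left_field by blast
      define z where "z = max x ((c + s) / 2)"
      have z: "x \<le> z" "z < s" "c < z" using c(1) \<open>x < s\<close> by (auto simp: z_def less_max_iff_disj)
      have "\<bar>\<phi> y - \<phi> t\<bar> \<le> e * (W y - W t)" if t: "z \<le> t" "t \<le> y" for t
      proof (cases "t < s")
        case True
        then have "\<bar>\<phi> t - \<phi> s\<bar> / (W s - W t) < e"
          using c(2)[of t] z t W_less[OF True] by (simp add: abs_divide)
        then have "\<bar>\<phi> t - \<phi> s\<bar> \<le> e * (W s - W t)"
          using W_less[OF True] by (simp add: divide_simps)
        then show ?thesis using at_s by (simp add: right_diff_distrib)
      next
        case False
        then show ?thesis using at_s right[of t] t by (cases "t = s") auto
      qed
      then have "z \<in> S" using z sy by (auto simp: S_def)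
      then have "s \<le> z" unfolding s_def using bdd by (rule cInf_lower)
      then show False using z by simp
    qed
    then show ?thesis using at_s by simp
  qed
  have "\<phi> x = \<phi> y" if "x < y" for x y
  proof -
    have "\<bar>\<phi> y - \<phi> x\<bar> \<le> 0 + e" if "e > 0" for e
      using main[OF \<open>x < y\<close>, of "e / (W y - W x)"] that W_less[OF \<open>x < y\<close>] by simp
    then have "\<bar>\<phi> y - \<phi> x\<bar> \<le> 0" by (rule field_le_epsilon)
    then show ?thesis by simp
  qed
  then show ?thesis by (metis linorder_less_linear)
qed

text \<open>
  The signed integral from \<open>0\<close> to \<open>x\<close>.  Defined on the whole line, it makes sense of one-sided limits
  at \<open>0\<close>, and periodicity becomes a property to be proved.
\<close>

definition primitive :: "(real \<Rightarrow> real) \<Rightarrow> real \<Rightarrow> real" where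
  "primitive g x = (if 0 \<le> x then (LINT s:{0<..x}|mu. g s) else - (LINT s:{x<..0}|mu. g s))"

lemma Ioc_integrable:
  fixes g :: "real \<Rightarrow> real"
  assumes "g \<in> borel_measurable borel" "\<And>x. \<bar>g x\<bar> \<le> B"
  shows "set_integrable mu {a<..b} g"
  unfolding set_integrable_def
proof (rule Bochner_Integration.integrable_bound)
  have "emeasure mu {a<..b} < \<infinity>"
    by (cases "a \<le> b") (simp_all add: emeasure_Ioc)
  then show "integrable mu (\<lambda>x. B * indicator {a<..b} x)"
    by simp
  show "AE x in mu. norm (indicator {a<..b} x *\<^sub>R g x) \<le> norm (B * indicator {a<..b} x)"
    using assms(2) by (auto simp: indicator_def intro: order_trans[OF _ abs_ge_self])
qed (use assms in simp)

lemma Ioc_integral_combine: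
  fixes g :: "real \<Rightarrow> real"
  assumes "g \<in> borel_measurable borel" "\<And>x. \<bar>g x\<bar> \<le> B" "a \<le> b" "b \<le> c"
  shows "(LINT s:{a<..c}|mu. g s) = (LINT s:{a<..b}|mu. g s) + (LINT s:{b<..c}|mu. g s)"
proof -
  have "{a<..c} = {a<..b} \<union> {b<..c}" using assms by auto
  then show ?thesis
    using set_integral_Un[of "{a<..b}" "{b<..c}" mu g] Ioc_integrable[OF assms(1,2)] by auto
qed

lemma primitive_diff:
  assumes "g \<in> borel_measurable borel" "\<And>x. \<bar>g x\<bar> \<le> B" "a \<le> b"
  shows "primitive g b - primitive g a = (LINT s:{a<..b}|mu. g s)"
  using assms(3) Ioc_integral_combine[OF assms(1,2), of 0 a b] Ioc_integral_combine[OF assms(1,2), of a 0 b]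
    Ioc_integral_combine[OF assms(1,2), of a b 0]
  by (auto simp: primitive_def)

lemma Ioc_integral_bound:
  assumes "set_integrable mu {a<..b} u" "\<And>s. a < s \<Longrightarrow> s \<le> b \<Longrightarrow> \<bar>u s\<bar> \<le> e" "a \<le> b"
  shows "\<bar>LINT s:{a<..b}|mu. u s\<bar> \<le> e * (W b - W a)"
proof -
  have fin: "emeasure mu {a<..b} < \<infinity>"
    using assms by (simp add: emeasure_Ioc)
  have "\<bar>LINT s:{a<..b}|mu. u s\<bar> \<le> (LINT s|mu. e * indicator {a<..b} s)"
    unfolding set_lebesgue_integral_def
  proof (rule order_trans[OF integral_abs_bound integral_mono])
    show "integrable mu (\<lambda>x. \<bar>indicator {a<..b} x *\<^sub>R u x\<bar>)"
      using assms(1) by (auto simp: set_integrable_def)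
    show "integrable mu (\<lambda>s. e * indicator {a<..b} s)" using fin by simp
  qed (use assms(2) in \<open>auto simp: indicator_def\<close>)
  also have "\<dots> = e * (W b - W a)" using assms(3) by (simp add: measure_Ioc)
  finally show ?thesis .
qed

lemma primitive_bound:
  assumes "g \<in> borel_measurable borel" "\<And>x. \<bar>g x\<bar> \<le> B" "a \<le> b"
  shows "\<bar>primitive g b - primitive g a\<bar> \<le> B * (W b - W a)"
  unfolding primitive_diff[OF assms]
  by (rule Ioc_integral_bound[OF Ioc_integrable[OF assms(1,2)]]) (use assms in auto)

text \<open>
  The increments of the primitive are at most \<open>B\<close> times those of \<open>W\<close>.  Thus it inherits right
  continuity from \<open>W\<close>, and it becomes monotone when \<open>B * W\<close> is added, so it has left limits.
\<close>

lemma cadlag_primitive: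
  assumes g: "g \<in> borel_measurable borel" "\<And>x. \<bar>g x\<bar> \<le> B"
  shows "cadlag (primitive g)"
  unfolding cadlag_def
proof (intro allI conjI)
  fix x
  have W_lim: "((\<lambda>y. B * (W y - W x)) \<longlongrightarrow> B * (W x - W x)) (at_right x)"
    using W_right_cont[of x] unfolding continuous_within by (intro tendsto_intros)
  have "\<forall>\<^sub>F y in at_right x. norm (primitive g y - primitive g x) \<le> B * (W y - W x)"
    using eventually_at_right_real[of x "x + 1"] primitive_bound[OF g] by (auto elim!: eventually_mono)
  then have "((\<lambda>y. primitive g y - primitive g x) \<longlongrightarrow> 0) (at_right x)"
    by (rule Lim_null_comparison) (use W_lim in simp)
  then show "continuous (at_right x) (primitive g)"
    by (simp add: continuous_within LIM_zero_iff)
  define \<psi> where "\<psi> y = primitive g y + B * W y" for y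
  have mono: "\<psi> y \<le> \<psi> z" if "y \<le> z" for y z
    using primitive_bound[OF g that] by (simp add: \<psi>_def right_diff_distrib)
  have "(\<psi> \<longlongrightarrow> Sup (\<psi> ` {..<x})) (at_left x)"
  proof (rule increasing_tendsto)
    have bdd: "bdd_above (\<psi> ` {..<x})"
      by (rule bdd_aboveI[of _ "\<psi> x"]) (auto intro: mono)
    show "\<forall>\<^sub>F y in at_left x. \<psi> y \<le> Sup (\<psi> ` {..<x})"
      using eventually_at_left_real[of "x - 1" x] bdd by (auto elim!: eventually_mono intro: cSup_upper)
    fix a assume "a < Sup (\<psi> ` {..<x})"
    then obtain z where z: "z < x" "a < \<psi> z"
      using less_cSup_iff[OF _ bdd] by auto
    show "\<forall>\<^sub>F y in at_left x. a < \<psi> y"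
      using eventually_at_left_real[OF z(1)] by eventually_elim (use z mono in \<open>force intro: less_le_trans\<close>)
  qed
  moreover obtain l where "(W \<longlongrightarrow> l) (at_left x)"
    using cadlag by (auto simp: cadlag_def)
  ultimately have "((\<lambda>y. \<psi> y - B * W y) \<longlongrightarrow> Sup (\<psi> ` {..<x}) - B * l) (at_left x)"
    by (intro tendsto_intros)
  then show "\<exists>l. (primitive g \<longlongrightarrow> l) (at_left x)"
    by (auto simp: \<psi>_def)
qed

text \<open>
  The difference quotient at \<open>x\<close> is the \<open>dW\<close>-average of \<open>g\<close> over \<open>(y, x]\<close>, on which \<open>g\<close> is close to
  \<open>g x\<close> by left continuity; the endpoint \<open>x\<close> may carry an atom, but there \<open>g\<close> equals \<open>g x\<close>.
\<close>

lemma has_left_deriv_primitive: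
  assumes g: "caglad g" "\<And>x. \<bar>g x\<bar> \<le> B"
  shows "has_left_deriv W (primitive g) g"
  unfolding has_left_deriv_def
proof
  fix x
  have gm: "g \<in> borel_measurable borel" using g by (intro caglad_measurable)
  show "((\<lambda>y. (primitive g y - primitive g x) / (W y - W x)) \<longlongrightarrow> g x) (at_left x)"
  proof (rule tendstoI)
    fix e :: real assume "e > 0"
    have "(g \<longlongrightarrow> g x) (at_left x)" using g by (simp add: caglad_def continuous_within)
    then have "\<forall>\<^sub>F y in at_left x. \<bar>g y - g x\<bar> < e/2"
      using \<open>e > 0\<close> by (auto dest: tendstoD[where e="e/2"] simp: dist_real_def)
    then obtain c where c: "c < x" "\<And>y. c < y \<Longrightarrow> y < x \<Longrightarrow> \<bar>g y - g x\<bar> < e/2"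
      unfolding eventually_at_left_field by blast
    show "\<forall>\<^sub>F y in at_left x. dist ((primitive g y - primitive g x) / (W y - W x)) (g x) < e"
      using eventually_at_left_real[OF c(1)]
    proof eventually_elim
      case (elim y)
      have int: "set_integrable mu {y<..x} g" by (rule Ioc_integrable[OF gm g(2)])
      have intc: "set_integrable mu {y<..x} (\<lambda>s. g x)"
        by (rule Ioc_integrable[where B="\<bar>g x\<bar>"]) auto
      have "(LINT s:{y<..x}|mu. g s - g x) = (primitive g x - primitive g y) - g x * (W x - W y)"
        using elim int intc primitive_diff[OF gm g(2), of y x] measure_Ioc[of y x] 
        by (subst set_integral_diff) (simp_all add: set_lebesgue_integral_def mult.commute)
      moreover have "\<bar>LINT s:{y<..x}|mu. g s - g x\<bar> \<le> e/2 * (W x - W y)"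
      proof (rule Ioc_integral_bound)
        show "\<bar>g s - g x\<bar> \<le> e/2" if "y < s" "s \<le> x" for s
          using c(2)[of s] that elim \<open>e > 0\<close> by (cases "s = x") auto
      qed (use elim int intc in auto)
      ultimately have "\<bar>(primitive g x - primitive g y) - g x * (W x - W y)\<bar> \<le> e/2 * (W x - W y)"
        by simp
      moreover have Wl: "W x - W y > 0" using elim W_less[of y x] by simp
      ultimately have "\<bar>(primitive g x - primitive g y) / (W x - W y) - g x\<bar> \<le> e/2"
        by (simp add: abs_le_iff field_simps)
      moreover have "(primitive g y - primitive g x) / (W y - W x) = (primitive g x - primitive g y) / (W x - W y)"
        by (metis minus_diff_eq minus_divide_divide)
      ultimately show ?case using \<open>e > 0\<close> by (simp add: dist_real_def)
    qed
  qed
qed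

lemma integral_left_deriv:
  assumes f: "\<And>x. continuous (at_right x) f" "has_left_deriv W f g"
    and g: "caglad g" "\<And>x. \<bar>g x\<bar> \<le> B" and "a \<le> b"
  shows "(LINT s:{a<..b}|mu. g s) = f b - f a"
proof -
  have gm: "g \<in> borel_measurable borel" using g by (intro caglad_measurable)
  have "f a + (- 1) * primitive g a = f b + (- 1) * primitive g b"
  proof (rule left_deriv_0_imp_constant[where \<phi> = "\<lambda>x. f x + (- 1) * primitive g x"])
    show "continuous (at_right x) (\<lambda>x. f x + (- 1) * primitive g x)" for x
      using f(1) cadlag_primitive[OF gm g(2)]
      by (intro continuous_add continuous_mult_left) (auto simp: cadlag_def)
    show "has_left_deriv W (\<lambda>x. f x + (- 1) * primitive g x) (\<lambda>x. 0)"
      using has_left_deriv_add[OF f(2) has_left_deriv_cmult[OF has_left_deriv_primitive[OF g], of "-1"]]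
      by simp
  qed
  then show ?thesis using primitive_diff[OF gm g(2) \<open>a \<le> b\<close>] by simp
qed

text \<open>
  The primitive and its translate by \<open>1\<close> have the same left derivative, so they differ by a constant,
  which is the integral over any one period.
\<close>

lemma periodic_primitive:
  assumes W: "periodic_increments W" and g: "caglad g" "periodic1 g" "(LINT s:{a<..a + 1}|mu. g s) = 0"
  shows "periodic1 (primitive g)"
  unfolding periodic1_def
proof
  fix x
  obtain B where B: "\<And>x. \<bar>g x\<bar> \<le> B" using caglad_periodic_bounded[OF g(1,2)] by auto
  have gm: "g \<in> borel_measurable borel" using g by (intro caglad_measurable)
  let ?P = "primitive g"
  have W1: "W (x + 1) = W x + (W 1 - W 0)" for x
    using W by (auto simp: periodic_increments_def algebra_simps)
  have shift: "has_left_deriv W (\<lambda>x. ?P (x + 1)) g"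
    unfolding has_left_deriv_def
  proof
    fix x
    have "((\<lambda>y. (?P y - ?P (x + 1)) / (W y - W (x + 1))) \<longlongrightarrow> g (x + 1)) (at_left (x + 1))"
      using has_left_deriv_primitive[OF g(1) B] by (simp add: has_left_deriv_def)
    then have "((\<lambda>y. (?P (y - -1) - ?P (x + 1)) / (W (y - -1) - W (x + 1))) \<longlongrightarrow> g (x + 1)) (at_left x)"
      by (rule filterlim_compose) (use filterlim_shift_at_left[of "-1" x] in simp)
    then show "((\<lambda>y. (?P (y + 1) - ?P (x + 1)) / (W y - W x)) \<longlongrightarrow> g x) (at_left x)"
      using g(2) by (simp add: W1 periodic1_def)
  qed
  have "?P (x + 1) + (- 1) * ?P x = ?P (a + 1) + (- 1) * ?P a"
  proof (rule left_deriv_0_imp_constant[where \<phi> = "\<lambda>x. ?P (x + 1) + (- 1) * ?P x"])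
    have P: "continuous (at_right x) ?P" for x
      using cadlag_primitive[OF gm B] by (simp add: cadlag_def)
    have "(?P \<longlongrightarrow> ?P (x + 1)) (at_right (x - -1))" for x
      using P[of "x + 1"] by (simp add: continuous_within)
    then have "((\<lambda>y. ?P (y - -1)) \<longlongrightarrow> ?P (x + 1)) (at_right x)" for x
      using filterlim_compose filterlim_shift_at_right by blast
    then have "continuous (at_right x) (\<lambda>x. ?P (x + 1))" for x
      by (simp add: continuous_within)
    with P show "continuous (at_right x) (\<lambda>x. ?P (x + 1) + (- 1) * ?P x)" for x
      by (intro continuous_add continuous_mult_left)
    show "has_left_deriv W (\<lambda>x. ?P (x + 1) + (- 1) * ?P x) (\<lambda>x. 0)"
      using has_left_deriv_add[OF shift has_left_deriv_cmult[OF has_left_deriv_primitive[OF g(1) B], of "-1"]]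
      by simp
  qed
  then show "?P (x + 1) = ?P x"
    using g(3) primitive_diff[OF gm B, of a "a + 1"] by simp
qed

end

section \<open>Periodicity of lateral derivatives\<close>

lemma periodic_increments_add1: "periodic_increments W \<Longrightarrow> W (x + 1) = W x + (W 1 - W 0)"
  by (auto simp: periodic_increments_def algebra_simps)

lemma periodic_increments_reflect:
  assumes "periodic_increments V"
  shows "periodic_increments (\<lambda>x. - V (- x))"
  unfolding periodic_increments_def
proof
  fix x
  have "V (- x) = V (- (x + 1)) + (V 1 - V 0)"
    using periodic_increments_add1[OF assms, of "- (x + 1)"] by simp
  moreover have "V 0 = V (- 1) + (V 1 - V 0)"
    using periodic_increments_add1[OF assms, of "- 1"] by simp
  ultimately show "- V (- (x + 1)) - - V (- x) = - V (- 1) - - V (- 0)" by simp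
qed

lemma periodic_left_deriv:
  assumes W: "periodic_increments W" and f: "periodic1 f" "has_left_deriv W f g"
  shows "periodic1 g"
  unfolding periodic1_def
proof
  fix x
  have "((\<lambda>y. (f y - f (x + 1)) / (W y - W (x + 1))) \<longlongrightarrow> g (x + 1)) (at_left (x + 1))"
    using f(2) by (simp add: has_left_deriv_def)
  then have "((\<lambda>y. (f (y - -1) - f (x + 1)) / (W (y - -1) - W (x + 1))) \<longlongrightarrow> g (x + 1)) (at_left x)"
    by (rule filterlim_compose) (use filterlim_shift_at_left[of "-1" x] in simp)
  then have "((\<lambda>y. (f y - f x) / (W y - W x)) \<longlongrightarrow> g (x + 1)) (at_left x)"
    using f(1) by (simp add: periodic_increments_add1[OF W] periodic1_def)
  moreover have "((\<lambda>y. (f y - f x) / (W y - W x)) \<longlongrightarrow> g x) (at_left x)"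
    using f(2) by (simp add: has_left_deriv_def)
  ultimately show "g (x + 1) = g x"
    by (rule tendsto_unique[OF trivial_limit_at_left_real])
qed

lemma periodic_right_deriv:
  assumes V: "periodic_increments V" and g: "periodic1 g" "has_right_deriv V g k"
  shows "periodic1 k"
proof -
  have "periodic1 (\<lambda>x. - g (- x))"
    using periodic1_reflect[OF g(1)] by (simp add: periodic1_def)
  then have "periodic1 (\<lambda>x. k (- x))"
    using periodic_left_deriv periodic_increments_reflect[OF V] g(2) has_right_deriv_reflect by blast
  from periodic1_reflect[OF this] show ?thesis by simp
qed

section \<open>Integration over the circle\<close>

locale circle_clocks =
  fixes W V :: "real \<Rightarrow> real"
  assumes W_strict: "strict_mono W" and W_cadlag: "cadlag W" and W_periodic: "periodic_increments W"
    and W_cont_0: "isCont W 0"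
    and V_strict: "strict_mono V" and V_caglad: "caglad V" and V_periodic: "periodic_increments V"
begin

sublocale W: cadlag_clock W
  by (simp add: cadlag_clock_def W_strict W_cadlag)

sublocale U: cadlag_clock "\<lambda>x. - V (- x)"
proof
  show "strict_mono (\<lambda>x. - V (- x))"
    using V_strict by (simp add: strict_mono_def)
  show "cadlag (\<lambda>x. - V (- x))"
    using cadlag_cmult[of "\<lambda>x. V (- x)" "-1"] V_caglad by (simp add: cadlag_reflect)
qed

lemma space_dW [simp]: "space (dW W) = {0..<1}" and space_dV [simp]: "space (dV V) = {0..<1}"
  by (auto simp: dW_def dV_def left_interval_measure_def space_restrict_space)

lemma sets_dW: "sets (dW W) = sets (restrict_space borel {0..<1})"
  by (simp add: dW_def sets_restrict_space)

lemma sets_left_interval_measure [simp]: "sets (left_interval_measure V) = sets borel"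
  by (simp add: left_interval_measure_def)

lemma sets_dV: "sets (dV V) = sets (restrict_space borel {0..<1})"
  by (simp add: dV_def sets_restrict_space)

lemma borel_dW: "g \<in> borel_measurable borel \<Longrightarrow> g \<in> borel_measurable (dW W)"
  and borel_dV: "g \<in> borel_measurable borel \<Longrightarrow> g \<in> borel_measurable (dV V)"
  for g :: "real \<Rightarrow> real"
  by (simp_all add: measurable_cong_sets[OF sets_dW refl] measurable_cong_sets[OF sets_dV refl]
      measurable_restrict_space1)

lemma emeasure_dV:
  assumes "0 \<le> a" "a \<le> b" "b \<le> 1"
  shows "emeasure (dV V) {a..<b} = ennreal (V b - V a)"
proof -
  have "emeasure (dV V) {a..<b} = emeasure (left_interval_measure V) {a..<b}"
    unfolding dV_def using assms by (subst emeasure_restrict_space) auto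
  also have "\<dots> = ennreal (V b - V a)"
    using V_strict V_caglad \<open>a \<le> b\<close>
    by (intro emeasure_left_interval_measure) (auto simp: caglad_def strict_mono_mono)
  finally show ?thesis .
qed

sublocale DV: finite_line_measure "dV V"
proof (unfold finite_line_measure_def, rule finite_measureI)
  show "emeasure (dV V) (space (dV V)) \<noteq> \<infinity>"
    using emeasure_dV[of 0 1] by simp
qed

sublocale DW: finite_line_measure "dW W"
proof (unfold finite_line_measure_def, rule finite_measureI)
  have "emeasure (dW W) (space (dW W)) = emeasure W.mu {0..<1}"
    unfolding dW_def by (subst emeasure_restrict_space) (auto simp: space_restrict_space)
  also have "\<dots> \<le> emeasure W.mu {-1<..1}" by (rule emeasure_mono) auto
  also have "\<dots> < \<infinity>" using W.emeasure_Ioc[of "-1" 1] by simp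
  finally show "emeasure (dW W) (space (dW W)) \<noteq> \<infinity>" by simp
qed

lemma measure_dV: "0 \<le> a \<Longrightarrow> a \<le> b \<Longrightarrow> b \<le> 1 \<Longrightarrow> measure (dV V) {a..<b} = V b - V a"
  using V_strict by (simp add: measure_def emeasure_dV strict_mono_less_eq)

text \<open>
  The measure \<open>dW\<close> is carried by \<open>{0..<1}\<close> whereas primitives are integrals over \<open>(0, x]\<close>.  As \<open>W\<close> is
  continuous at \<open>0\<close>, and by periodicity at \<open>1\<close>, the endpoints have no mass and both agree.
\<close>

lemma null_singleton:
  assumes "isCont W x"
  shows "emeasure W.mu {x} = 0"
proof -
  have "(\<lambda>y. ennreal (W x - W y)) \<midarrow>x\<rightarrow> ennreal (W x - W x)"
    using assms unfolding isCont_def by (intro tendsto_intros)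
  then have lim: "((\<lambda>y. ennreal (W x - W y)) \<longlongrightarrow> 0) (at_left x)"
    unfolding filterlim_at_split by simp
  have "\<forall>\<^sub>F y in at_left x. emeasure W.mu {x} \<le> ennreal (W x - W y)"
    using eventually_at_left_real[of "x - 1" x]
  proof (rule eventually_mono)
    fix y assume "y \<in> {x - 1<..<x}"
    then show "emeasure W.mu {x} \<le> ennreal (W x - W y)"
      by (subst W.emeasure_Ioc[symmetric]) (auto intro!: emeasure_mono)
  qed simp
  from tendsto_lowerbound[OF lim this trivial_limit_at_left_real] show ?thesis by simp
qed

lemma W_cont_1: "isCont W 1"
proof -
  have "isCont (\<lambda>x. W (x - 1)) 1"
    using isCont_o2[where a = 1 and f = "\<lambda>x. x - 1" and g = W] W_cont_0 by simp
  then have "isCont (\<lambda>x. W (x - 1) + (W 1 - W 0)) 1"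
    by (rule continuous_add) simp
  moreover have "(\<lambda>x. W (x - 1) + (W 1 - W 0)) = W"
  proof
    show "W (x - 1) + (W 1 - W 0) = W x" for x
      using periodic_increments_add1[OF W_periodic, of "x - 1"] by simp
  qed
  ultimately show ?thesis by simp
qed

lemma AE_dW_nonzero: "AE s in dW W. 0 < s"
proof (rule AE_I)
  have "emeasure (dW W) {0} = emeasure W.mu {0}"
    unfolding dW_def by (subst emeasure_restrict_space) auto
  then show "emeasure (dW W) {0} = 0" using null_singleton[OF W_cont_0] by simp
  show "{0} \<in> sets (dW W)" by (auto simp: sets_dW sets_restrict_space)
qed auto

lemma integral_dW:
  fixes g :: "real \<Rightarrow> real"
  assumes "g \<in> borel_measurable borel" "0 \<le> x" "x \<le> 1"
  shows "(LINT s:{0<..x}|dW W. g s) = (LINT s:{0<..x}|W.mu. g s)"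
proof -
  have "AE s in W.mu. s \<noteq> 1"
    using null_singleton[OF W_cont_1] by (intro AE_I[of _ _ "{1}"]) auto
  then have "(LINT s|W.mu. indicator {0..<1} s *\<^sub>R (indicator {0<..x} s *\<^sub>R g s)) =
      (LINT s|W.mu. indicator {0<..x} s *\<^sub>R g s)"
    using assms by (intro integral_cong_AE) (auto simp: indicator_def)
  then show ?thesis
    unfolding set_lebesgue_integral_def dW_def by (subst integral_restrict_space) auto
qed

lemma integral_dW_eq:
  "(LINT s:{0<..1}|dW W. g s) = (LINT s|dW W. (g s :: real))" if "g \<in> borel_measurable (dW W)"
  unfolding set_lebesgue_integral_def
proof (rule integral_cong_AE)
  have "(\<lambda>s. indicator {0<..1} s :: real) \<in> borel_measurable (dW W)"
    by (rule borel_dW) simp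
  then show "(\<lambda>s. indicator {0<..1} s *\<^sub>R g s) \<in> borel_measurable (dW W)"
    using that by simp
  show "AE s in dW W. indicator {0<..1} s *\<^sub>R g s = g s"
    using AE_dW_nonzero AE_space by eventually_elim (auto simp: indicator_def)
qed fact

lemma integral_dV:
  fixes k :: "real \<Rightarrow> real"
  assumes "k \<in> borel_measurable borel" "0 \<le> a" "b \<le> 1"
  shows "(LINT x:{a..<b}|dV V. k x) = (LINT s:{- b<..- a}|U.mu. k (- s))"
proof -
  have "(LINT x:{a..<b}|dV V. k x) =
      (LINT x|left_interval_measure V. indicator {0..<1} x *\<^sub>R (indicator {a..<b} x *\<^sub>R k x))"
    unfolding set_lebesgue_integral_def dV_def by (subst integral_restrict_space) auto
  also have "\<dots> = (LINT s|U.mu. indicator {0..<1} (- s) *\<^sub>R (indicator {a..<b} (- s) *\<^sub>R k (- s)))"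
    unfolding left_interval_measure_def using assms(1) by (subst integral_distr) auto
  also have "\<dots> = (LINT s:{- b<..- a}|U.mu. k (- s))"
    unfolding set_lebesgue_integral_def using assms
    by (intro Bochner_Integration.integral_cong) (auto simp: indicator_def)
  finally show ?thesis .
qed

section \<open>The energy identity\<close>

text \<open>
  A flux is a function that has the regularity required of \<open>D\<^sup>-\<^sub>W f\<close> for \<open>f\<close> in the domain, with
  \<open>k\<close> its right derivative.
\<close>

definition flux :: "(real \<Rightarrow> real) \<Rightarrow> (real \<Rightarrow> real) \<Rightarrow> bool" where
  "flux g k \<longleftrightarrow> periodic1 g \<and> caglad g \<and> has_right_deriv V g k \<and> cadlag k"

text \<open>
  Membership of \<open>f\<close> in \<^const>\<open>D_space\<close> with its first derivative \<open>g\<close> and its second derivative \<open>k\<close>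
  made explicit.
\<close>

definition smooth :: "(real \<Rightarrow> real) \<Rightarrow> (real \<Rightarrow> real) \<Rightarrow> (real \<Rightarrow> real) \<Rightarrow> bool" where
  "smooth f g k \<longleftrightarrow> periodic1 f \<and> cadlag f \<and> has_left_deriv W f g \<and> flux g k"

lemma smooth_of_D_space:
  assumes "f \<in> D_space W V"
  shows "smooth f (D_left W f) (D_right V (D_left W f))"
proof -
  have "has_left_deriv W f (D_left W f)" "periodic1 f"
    using assms by (simp_all add: D_space_def has_left_deriv_iff)
  then have "periodic1 (D_left W f)" using periodic_left_deriv[OF W_periodic] by blast
  then show ?thesis
    using assms by (simp add: D_space_def smooth_def flux_def has_left_deriv_iff has_right_deriv_iff)
qed

lemma D_space_of_smooth:
  assumes "smooth f g k"
  shows "f \<in> D_space W V" "D_left W f = g" "D_right V g = k"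
  using assms by (auto simp: D_space_def smooth_def flux_def has_left_deriv_iff has_right_deriv_iff)

lemma flux_linear: "flux g k \<Longrightarrow> flux g' k' \<Longrightarrow> flux (\<lambda>x. g x + c * g' x) (\<lambda>x. k x + c * k' x)"
  unfolding flux_def
  by (auto simp: periodic1_def intro!: caglad_add caglad_cmult has_right_deriv_add has_right_deriv_cmult
      cadlag_add cadlag_cmult)

lemma flux_const: "flux (\<lambda>x. c) (\<lambda>x. 0)"
  by (simp add: flux_def periodic1_def caglad_const has_right_deriv_const cadlag_const)

lemma smooth_diff:
  assumes "smooth f g k" "smooth f' g' k'"
  shows "smooth (\<lambda>x. f x - f' x) (\<lambda>x. g x - g' x) (\<lambda>x. k x - k' x)"
  using assms flux_linear[of g k g' k' "-1"] cadlag_add[of f "\<lambda>x. -1 * f' x"] cadlag_cmult[of f' "-1"]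
    has_left_deriv_add[of W f g "\<lambda>x. -1 * f' x" "\<lambda>x. -1 * g' x"] has_left_deriv_cmult[of W f' g' "-1"]
  by (auto simp: smooth_def periodic1_def)

lemma flux_bounded:
  assumes "flux g k"
  shows "\<exists>B. \<forall>x. \<bar>g x\<bar> \<le> B" "\<exists>C. \<forall>x. \<bar>k x\<bar> \<le> C"
    "g \<in> borel_measurable borel" "k \<in> borel_measurable borel" "g \<in> L2 (dW W)"
proof -
  have per: "periodic1 k"
    using assms periodic_right_deriv[OF V_periodic] by (auto simp: flux_def)
  show *: "\<exists>B. \<forall>x. \<bar>g x\<bar> \<le> B" and "\<exists>C. \<forall>x. \<bar>k x\<bar> \<le> C"
    using assms caglad_periodic_bounded cadlag_periodic_bounded per by (auto simp: flux_def)
  show meas: "g \<in> borel_measurable borel" and "k \<in> borel_measurable borel"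
    using assms caglad_measurable cadlag_measurable by (auto simp: flux_def)
  show "g \<in> L2 (dW W)"
    using * by (auto intro!: DW.L2_bounded borel_dW meas)
qed

lemma smooth_bounded:
  assumes "smooth f g k"
  shows "\<exists>A. \<forall>x. \<bar>f x\<bar> \<le> A" "f \<in> borel_measurable borel" "f \<in> L2 (dV V)"
proof -
  show *: "\<exists>A. \<forall>x. \<bar>f x\<bar> \<le> A" and meas: "f \<in> borel_measurable borel"
    using assms cadlag_periodic_bounded cadlag_measurable by (auto simp: smooth_def)
  show "f \<in> L2 (dV V)"
    using * by (auto intro!: DV.L2_bounded borel_dV meas)
qed

lemma smooth_eq_integral:
  assumes "smooth f g k" "0 \<le> x" "x \<le> 1"
  shows "f x = f 0 + (LINT s:{0<..x}|dW W. g s)"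
proof -
  note g = assms(1)[unfolded smooth_def flux_def]
  obtain B where B: "\<And>x. \<bar>g x\<bar> \<le> B" using caglad_periodic_bounded g by blast
  have "(LINT s:{0<..x}|W.mu. g s) = f x - f 0"
    using g B assms(2) by (intro W.integral_left_deriv) (auto simp: cadlag_def)
  then show ?thesis using integral_dW[of g x] g caglad_measurable assms by auto
qed

lemma smooth_deriv_integral_zero:
  assumes "smooth f g k"
  shows "(LINT s|dW W. g s) = 0"
proof -
  have "f 1 = f 0" using assms by (auto simp: smooth_def periodic1_def dest: spec[of _ 0])
  then show ?thesis
    using smooth_eq_integral[OF assms, of 1] integral_dW_eq[of g] flux_bounded(5)[of g k] assms
    by (simp add: smooth_def L2_def)
qed

lemma flux_integral:
  assumes "flux g k" "0 \<le> a" "a \<le> b" "b \<le> 1"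
  shows "(LINT x:{a..<b}|dV V. k x) = g b - g a"
proof -
  obtain C where C: "\<And>x. \<bar>k x\<bar> \<le> C" using flux_bounded[OF assms(1)] by blast
  have "(LINT s:{- b<..- a}|U.mu. k (- s)) = - g (- (- a)) - - g (- (- b))"
  proof (rule U.integral_left_deriv)
    show "continuous (at_right x) (\<lambda>x. - g (- x))" for x
      using assms(1) by (intro continuous_minus) (auto simp: flux_def caglad_def continuous_at_right_reflect)
    show "has_left_deriv (\<lambda>x. - V (- x)) (\<lambda>x. - g (- x)) (\<lambda>x. k (- x))"
      using assms(1) by (simp add: flux_def has_right_deriv_reflect)
    show "caglad (\<lambda>x. k (- x))"
      using assms(1) by (simp add: flux_def caglad_reflect)
  qed (use C assms in auto)
  then show ?thesis using integral_dV[of k a b] flux_bounded(4)[OF assms(1)] assms by simp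
qed

text \<open>
  Write \<open>f x\<close> as \<open>f 0\<close> plus the integral of \<open>g\<close> over \<open>(0, x]\<close> and exchange the order of integration:
  the inner integral of \<open>k\<close> over \<open>[s, 1)\<close> is \<open>g 1 - g s\<close>.  The boundary terms \<open>f 0 * (g 1 - g 0)\<close> and
  \<open>g 1 * (f 1 - f 0)\<close> vanish by periodicity.  A common atom of \<open>dW\<close> and \<open>dV\<close> causes no extra term
  because \<open>(0, x]\<close> is closed on the right and \<open>[s, 1)\<close> on the left, matching \<open>s \<le> x\<close>.
\<close>

lemma integral_by_parts:
  assumes "smooth f g k"
  shows "(LINT x|dV V. k x * f x) = - (LINT s|dW W. (g s)\<^sup>2)"
proof -
  have fl: "flux g k" using assms by (simp add: smooth_def)
  note [measurable] = flux_bounded(3,4)[OF fl]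
  obtain B C where B: "\<And>x. \<bar>g x\<bar> \<le> B" and C: "\<And>x. \<bar>k x\<bar> \<le> C"
    using flux_bounded(1,2)[OF fl] by blast
  have "B \<ge> 0" "C \<ge> 0" using B[of 0] C[of 0] by auto
  have kL2: "k \<in> L2 (dV V)" by (rule DV.L2_bounded[OF borel_dV C]) simp
  have gL2: "g \<in> L2 (dW W)" by (rule flux_bounded(5)[OF fl])
  interpret pair: pair_sigma_finite "dW W" "dV V" ..
  interpret P: finite_measure "dW W \<Otimes>\<^sub>M dV V"
    by (rule finite_measure_pair_measure) unfold_locales
  define h where "h s x = (if 0 < s \<and> s \<le> x then g s * k x else 0)" for s x
  have [measurable]: "(\<lambda>s. s) \<in> borel_measurable (dW W)" "(\<lambda>x. x) \<in> borel_measurable (dV V)"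
    by (auto intro: borel_dW borel_dV)
  have h_int: "integrable (dW W \<Otimes>\<^sub>M dV V) (case_prod h)"
  proof (rule P.integrable_const_bound[where B = "B * C"])
    show "AE p in dW W \<Otimes>\<^sub>M dV V. norm (case_prod h p) \<le> B * C"
      using B C \<open>B \<ge> 0\<close> \<open>C \<ge> 0\<close> by (intro AE_I2) (auto simp: h_def abs_mult intro!: mult_mono)
    show "case_prod h \<in> borel_measurable (dW W \<Otimes>\<^sub>M dV V)"
      unfolding h_def by measurable
  qed
  have k_total: "(LINT x|dV V. k x) = g 1 - g 0"
  proof -
    have "(LINT x|dV V. k x) = (LINT x:{0..<1}|dV V. k x)"
      unfolding set_lebesgue_integral_def by (intro Bochner_Integration.integral_cong) auto
    then show ?thesis using flux_integral[OF fl, of 0 1] by simp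
  qed
  have g1: "g 1 = g 0" using fl by (auto simp: flux_def periodic1_def dest: spec[of _ 0])
  have inner_s: "k x * f x = f 0 * k x + (LINT s|dW W. h s x)" if "x \<in> space (dV V)" for x
  proof -
    have "(LINT s|dW W. h s x) = (LINT s|dW W. (indicator {0<..x} s *\<^sub>R g s) * k x)"
      by (intro Bochner_Integration.integral_cong) (auto simp: h_def indicator_def)
    also have "\<dots> = (f x - f 0) * k x"
      using smooth_eq_integral[OF assms, of x] that by (simp add: set_lebesgue_integral_def)
    finally show ?thesis by (simp add: algebra_simps)
  qed
  have inner_x: "(LINT x|dV V. h s x) = g 1 * g s - (g s)\<^sup>2" if "0 < s" "s \<in> space (dW W)" for s
  proof -
    have "(LINT x|dV V. h s x) = (LINT x|dV V. g s * (indicator {s..<1} x *\<^sub>R k x))"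
      using that by (intro Bochner_Integration.integral_cong) (auto simp: h_def indicator_def)
    also have "\<dots> = g s * (g 1 - g s)"
      using flux_integral[OF fl, of s 1] that by (simp add: set_lebesgue_integral_def)
    finally show ?thesis by (simp add: algebra_simps power2_eq_square)
  qed
  have "(LINT x|dV V. k x * f x) = (LINT x|dV V. f 0 * k x + (LINT s|dW W. h s x))"
    by (intro Bochner_Integration.integral_cong inner_s refl)
  also have "\<dots> = f 0 * (LINT x|dV V. k x) + (LINT x|dV V. (LINT s|dW W. h s x))"
    using DV.L2_integrable[OF kL2] pair.integrable_snd[OF h_int] by simp
  also have "\<dots> = (LINT s|dW W. (LINT x|dV V. h s x))"
    unfolding pair.Fubini_integral[OF h_int] by (simp add: k_total g1)
  also have "\<dots> = (LINT s|dW W. g 1 * g s - (g s)\<^sup>2)"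
  proof (rule integral_cong_AE)
    show "(\<lambda>s. LINT x|dV V. h s x) \<in> borel_measurable (dW W)"
      using h_int by (intro DV.borel_measurable_lebesgue_integral) simp
    show "AE s in dW W. (LINT x|dV V. h s x) = g 1 * g s - (g s)\<^sup>2"
      using AE_dW_nonzero AE_space by eventually_elim (rule inner_x)
  qed measurable
  also have "\<dots> = g 1 * (LINT s|dW W. g s) - (LINT s|dW W. (g s)\<^sup>2)"
    using DW.L2_integrable[OF gL2] gL2 by (simp add: L2_def)
  finally show ?thesis by (simp add: smooth_deriv_integral_zero[OF assms])
qed

lemma energetic_norm_eq:
  assumes "smooth f g k"
  shows "energetic_norm W V f = sqrt ((LINT x|dV V. (f x)\<^sup>2) + (LINT s|dW W. (g s)\<^sup>2))"
proof -
  have fl: "flux g k" using assms by (simp add: smooth_def)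
  obtain C where C: "\<And>x. \<bar>k x\<bar> \<le> C"
    using flux_bounded(2)[OF fl] by blast
  have kL2: "k \<in> L2 (dV V)" by (rule DV.L2_bounded[OF borel_dV C]) (rule flux_bounded(4)[OF fl])
  note fL2 = smooth_bounded(3)[OF assms]
  have "(LINT x|dV V. (f x - k x) * f x) = (LINT x|dV V. (f x)\<^sup>2 - k x * f x)"
    by (simp add: algebra_simps power2_eq_square)
  also have "\<dots> = (LINT x|dV V. (f x)\<^sup>2) - (LINT x|dV V. k x * f x)"
    using fL2 DV.L2_mult_integrable[OF kL2 fL2] by (simp add: L2_def)
  finally show ?thesis
    unfolding energetic_norm_def L2_inner_def
    by (simp add: integral_by_parts[OF assms] D_space_of_smooth[OF assms])
qed

section \<open>Density of the fluxes in the square-integrable functions\<close>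

text \<open>
  The reflected primitive of the reflected \<open>k\<close>; mean zero of \<open>k\<close> is exactly what periodicity needs.
\<close>

lemma flux_exists:
  assumes k: "cadlag k" "periodic1 k" "(LINT x:{0..<1}|dV V. k x) = 0"
  shows "\<exists>g. flux g k \<and> (\<forall>y\<in>{0..1}. g y = c + (LINT x:{0..<y}|dV V. k x))"
proof -
  let ?k = "\<lambda>s. k (- s)" and ?P = "U.primitive (\<lambda>s. k (- s))"
  have cg: "caglad ?k" using k by (simp add: caglad_reflect)
  have per: "periodic1 ?k" by (rule periodic1_reflect[OF k(2)])
  have km: "k \<in> borel_measurable borel" by (rule cadlag_measurable[OF k(1)])
  obtain B where B: "\<And>s. \<bar>?k s\<bar> \<le> B" using caglad_periodic_bounded[OF cg per] by auto
  define g where "g y = c + (- 1) * ?P (- y)" for y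
  have "periodic1 ?P"
  proof (rule U.periodic_primitive[OF periodic_increments_reflect[OF V_periodic] cg per])
    show "(LINT s:{- 1<..- 1 + 1}|U.mu. k (- s)) = 0"
      using k(3) integral_dV[OF km, of 0 1] by simp
  qed
  from periodic1_reflect[OF this] have "periodic1 g" by (simp add: g_def periodic1_def)
  moreover have "caglad g"
    unfolding g_def using U.cadlag_primitive[OF caglad_measurable[OF cg] B]
    by (intro caglad_add caglad_const caglad_cmult) (simp add: caglad_reflect)
  moreover have "has_right_deriv V g k"
    unfolding has_right_deriv_reflect g_def
    using has_left_deriv_add[OF has_left_deriv_const[of _ "- c"] U.has_left_deriv_primitive[OF cg B]] by simp
  moreover have "g y = c + (LINT x:{0..<y}|dV V. k x)" if "y \<in> {0..1}" for y
    using that integral_dV[OF km, of 0 y]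
    by (cases "y = 0") (auto simp: g_def U.primitive_def set_lebesgue_integral_def)
  ultimately show ?thesis using k(1) by (auto simp: flux_def)
qed

lemma V_less: "x < y \<Longrightarrow> V x < V y"
  using V_strict by (simp add: strict_mono_less)

text \<open>
  The flux is the primitive of \<open>k\<close>, which is negative on \<open>[x, x + d)\<close>, positive on \<open>[1 - d, 1)\<close> and zero
  elsewhere on the period, normalised to have \<open>dV\<close>-mass \<open>- 1\<close> and \<open>1\<close> on these intervals.  Strict
  monotonicity of \<open>V\<close> makes the normalisation possible.
\<close>

lemma flux_step:
  assumes x: "0 \<le> x" "0 < d" "x + d \<le> 1 - d"
  shows "\<exists>g k. flux g k \<and> (\<forall>y\<in>{0..1}. \<bar>g y\<bar> \<le> 2) \<and> (\<forall>y\<in>{0..x}. g y = 1) \<and> (\<forall>y\<in>{x + d..1 - d}. g y = 0)"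
proof -
  define m where "m a b y = measure (dV V) ({0..<y} \<inter> {a..<b})" for a b y
  define \<alpha> where "\<alpha> = V (x + d) - V x"
  define \<beta> where "\<beta> = V 1 - V (1 - d)"
  have pos: "\<alpha> > 0" "\<beta> > 0" using x V_less[of x "x + d"] V_less[of "1 - d" 1] by (auto simp: \<alpha>_def \<beta>_def)
  \<comment> \<open>\<open>p\<close> and \<open>q\<close> are the fractions of the two masses that lie below \<open>y\<close>; the flux is \<open>1 + q - p\<close>.\<close>
  define p where "p y = m x (x + d) y / \<alpha>" for y
  define q where "q y = m (1 - d) 1 y / \<beta>" for y
  \<comment> \<open>The indicator of \<open>{a..<b}\<close> as a difference of cadlag functions.\<close>
  define ind where "ind a b y = (indicator {a..} y + (- 1) * indicator {b..} y :: real)" for a b y :: real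
  define k where "k y = (- 1 / \<alpha>) * ind x (x + d) (frac y) + (1 / \<beta>) * ind (1 - d) 1 (frac y)" for y
  have cadlag_k: "cadlag k"
    unfolding k_def ind_def
    by (intro cadlag_periodize cadlag_add cadlag_cmult cadlag_indicator_Ici)
  have per_k: "periodic1 k" by (simp add: k_def periodic1_def frac_1_eq)
  have ind_eq: "ind a b y = indicator {a..<b} y" if "a \<le> b" for a b y
    using that by (auto simp: ind_def indicator_def)
  have k_eq: "k y = (- 1 / \<alpha>) * indicator {x..<x + d} y + (1 / \<beta>) * indicator {1 - d..<1} y" if "y \<in> {0..<1}" for y
    using that x by (simp add: k_def ind_eq frac_eq[THEN iffD2])
  have sets: "{0..<y} \<inter> {a..<b} \<in> sets (dV V)" if "0 \<le> a" "b \<le> 1" for a b y :: real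
    using that by (auto simp: sets_dV sets_restrict_space intro!: image_eqI[where x = "{0..<y} \<inter> {a..<b}"])
  have int_k: "(LINT s:{0..<y}|dV V. k s) = q y - p y" for y
  proof -
    have "(LINT s:{0..<y}|dV V. k s) =
      (LINT s|dV V. (- 1 / \<alpha>) * indicator ({0..<y} \<inter> {x..<x + d}) s + (1 / \<beta>) * indicator ({0..<y} \<inter> {1 - d..<1}) s)"
      unfolding set_lebesgue_integral_def
      by (intro Bochner_Integration.integral_cong) (auto simp: k_eq indicator_def)
    also have "\<dots> = q y - p y"
      using sets[of x "x + d" y] sets[of "1 - d" 1 y] x
      by (simp add: p_def q_def m_def DV.emeasure_finite less_top[symmetric] sets.Int_space_eq2)
    finally show ?thesis .
  qed
  have m_low: "m a b y = 0" if "y \<le> a" for a b y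
  proof -
    have "{0..<y} \<inter> {a..<b} = {}" using that by auto
    then show ?thesis unfolding m_def by (simp only: measure_empty)
  qed
  have m_high: "m a b y = V b - V a" if "0 \<le> a" "a \<le> b" "b \<le> y" "b \<le> 1" for a b y
  proof -
    have "{0..<y} \<inter> {a..<b} = {a..<b}" using that by auto
    then show ?thesis using that by (simp add: m_def measure_dV)
  qed
  have m_bounds: "0 \<le> m a b y \<and> m a b y \<le> V b - V a" if "0 \<le> a" "a \<le> b" "b \<le> 1" for a b y
  proof -
    have "{a..<b} \<in> sets (dV V)" using sets[of a b 1] that by (simp add: Int_absorb1)
    then have "m a b y \<le> measure (dV V) {a..<b}"
      unfolding m_def by (intro DV.finite_measure_mono) auto
    then show ?thesis using that by (simp add: m_def measure_dV)
  qed
  have p01: "0 \<le> p y \<and> p y \<le> 1" and q01: "0 \<le> q y \<and> q y \<le> 1" for y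
    using m_bounds[of x "x + d" y] m_bounds[of "1 - d" 1 y] x pos
    by (auto simp: p_def q_def \<alpha>_def \<beta>_def)
  have p0: "p y = 0" if "y \<le> x" for y using that by (simp add: p_def m_low)
  have q0: "q y = 0" if "y \<le> 1 - d" for y using that by (simp add: q_def m_low)
  have p1: "p y = 1" if "x + d \<le> y" for y
    using that x pos by (simp add: p_def m_high \<alpha>_def)
  have q1: "q 1 = 1" using x pos by (simp add: q_def m_high \<beta>_def)
  have "(LINT s:{0..<1}|dV V. k s) = 0"
    unfolding int_k using p1[of 1] q1 x by simp
  from flux_exists[OF cadlag_k per_k this, of 1] obtain g where
    g: "flux g k" "\<And>y. y \<in> {0..1} \<Longrightarrow> g y = 1 + q y - p y"
    by (auto simp: int_k)
  show ?thesis
  proof (intro exI conjI ballI)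
    show "flux g k" by fact
    show "\<bar>g y\<bar> \<le> 2" if "y \<in> {0..1}" for y
      using g(2)[OF that] p01[of y] q01[of y] by linarith
    show "g y = 1" if "y \<in> {0..x}" for y
      using g(2)[of y] that x by (simp add: p0 q0)
    show "g y = 0" if "y \<in> {x + d..1 - d}" for y
      using g(2)[of y] that x by (simp add: p1 q0)
  qed
qed

definition flux_approximable :: "(real \<Rightarrow> real) \<Rightarrow> bool" where
  "flux_approximable u \<longleftrightarrow> u \<in> L2 (dW W) \<and>
    (\<forall>e>0. \<exists>g k. flux g k \<and> (LINT s|dW W. (u s - g s)\<^sup>2) < e)"

lemma flux_approximable_cong:
  assumes "u \<in> L2 (dW W)" "flux g k" "\<And>s. s \<in> {0..<1} \<Longrightarrow> u s = g s"
  shows "flux_approximable u"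
proof -
  have "(LINT s|dW W. (u s - g s)\<^sup>2) = (LINT s|dW W. 0)"
    using assms(3) by (intro Bochner_Integration.integral_cong) auto
  then have "(LINT s|dW W. (u s - g s)\<^sup>2) < e" if "e > 0" for e
    using that by simp
  then show ?thesis using assms(1,2) unfolding flux_approximable_def by blast
qed

lemma flux_approximable_lim:
  assumes u: "\<And>n. flux_approximable (u n)" and g: "g \<in> L2 (dW W)"
    and bound: "\<And>n s. s \<in> {0..<1} \<Longrightarrow> \<bar>u n s\<bar> \<le> g s"
    and lim: "\<And>s. s \<in> {0..<1} \<Longrightarrow> (\<lambda>n. u n s) \<longlonglongrightarrow> v s"
  shows "flux_approximable v"
proof -
  have uL2: "u n \<in> L2 (dW W)" for n using u by (simp add: flux_approximable_def)
  then have [measurable]: "u n \<in> borel_measurable (dW W)" for n by (simp add: L2_def)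
  have vm[measurable]: "v \<in> borel_measurable (dW W)"
    by (rule borel_measurable_LIMSEQ_real[where u = u]) (use lim in auto)
  have v_le: "\<bar>v s\<bar> \<le> g s" if "s \<in> {0..<1}" for s
    by (rule LIMSEQ_le_const2[OF tendsto_rabs[OF lim[OF that]]]) (use bound that in blast)
  have vL2: "v \<in> L2 (dW W)"
    by (rule DW.L2_bound[OF vm g]) (use v_le in \<open>auto intro: order_trans[OF _ abs_ge_self]\<close>)
  have "(\<lambda>n. LINT s|dW W. (v s - u n s)\<^sup>2) \<longlonglongrightarrow> (LINT s|dW W. 0)"
  proof (rule integral_dominated_convergence)
    show "integrable (dW W) (\<lambda>s. (2 * g s)\<^sup>2)"
      using DW.L2_cmult[OF g, of 2] by (simp add: L2_def)
    show "AE s in dW W. (\<lambda>n. (v s - u n s)\<^sup>2) \<longlonglongrightarrow> 0"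
    proof (rule AE_I2)
      fix s assume "s \<in> space (dW W)"
      then have "(\<lambda>n. (v s - u n s)\<^sup>2) \<longlonglongrightarrow> (v s - v s)\<^sup>2"
        using lim by (intro tendsto_intros) auto
      then show "(\<lambda>n. (v s - u n s)\<^sup>2) \<longlonglongrightarrow> 0" by simp
    qed
    show "AE s in dW W. norm ((v s - u n s)\<^sup>2) \<le> (2 * g s)\<^sup>2" for n
    proof (rule AE_I2)
      fix s assume "s \<in> space (dW W)"
      then have "\<bar>v s - u n s\<bar> \<le> 2 * g s" using bound[of s n] v_le[of s] by auto
      then show "norm ((v s - u n s)\<^sup>2) \<le> (2 * g s)\<^sup>2"
        using power_mono[of "\<bar>v s - u n s\<bar>" "2 * g s" 2] by simp
    qed
  qed measurable
  then have conv: "(\<lambda>n. LINT s|dW W. (v s - u n s)\<^sup>2) \<longlonglongrightarrow> 0" by simp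
  show ?thesis
    unfolding flux_approximable_def
  proof (intro conjI allI impI vL2)
    fix e :: real assume e: "e > 0"
    then obtain n where n: "(LINT s|dW W. (v s - u n s)\<^sup>2) < e / 4"
      using order_tendstoD(2)[OF conv, of "e / 4"] by (auto simp: eventually_sequentially)
    obtain h k where h: "flux h k" "(LINT s|dW W. (u n s - h s)\<^sup>2) < e / 4"
      using u[of n] e unfolding flux_approximable_def by (meson divide_pos_pos zero_less_numeral)
    have "(LINT s|dW W. (v s - h s)\<^sup>2) < e"
      using DW.integral_square_add_le[OF DW.L2_diff[OF vL2 uL2[of n]] DW.L2_diff[OF uL2[of n] flux_bounded(5)[OF h(1)]]]
        n h(2) by simp
    with h(1) show "\<exists>g k. flux g k \<and> (LINT s|dW W. (v s - g s)\<^sup>2) < e" by blast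
  qed
qed

lemma indicator_atMost_L2: "indicator {..x} \<in> L2 (dW W)"
  by (rule DW.L2_bounded[where B = 1]) (auto intro: borel_dW simp: indicator_def)

text \<open>
  Letting \<open>d\<close> shrink in \<open>flux_step\<close>, the fluxes tend to the indicator of the ray at every point of
  \<open>{0..<1}\<close> and stay bounded by \<open>2\<close>.
\<close>

lemma flux_approximable_ray: "flux_approximable (indicator {..x})"
proof -
  consider "x < 0" | "1 \<le> x" | "0 \<le> x" "x < 1" by linarith
  then show ?thesis
  proof cases
    case 1
    then show ?thesis
      by (intro flux_approximable_cong[OF indicator_atMost_L2 flux_const[of 0]]) (auto simp: indicator_def)
  next
    case 2
    then show ?thesis
      by (intro flux_approximable_cong[OF indicator_atMost_L2 flux_const[of 1]]) (auto simp: indicator_def)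
  next
    case 3
    define d where "d n = (1 - x) / (real n + 2)" for n
    have d: "0 < d n" "x + d n \<le> 1 - d n" for n
    proof -
      have "2 * d n \<le> 1 - x"
        using 3 mult_left_mono[of 2 "real n + 2" "1 - x"] by (simp add: d_def divide_le_eq mult.commute)
      then show "x + d n \<le> 1 - d n" by simp
    qed (use 3 in \<open>simp add: d_def\<close>)
    have d_lim: "d \<longlonglongrightarrow> 0"
      unfolding d_def by real_asymp
    have "\<exists>g. (\<exists>k. flux g k) \<and> (\<forall>y\<in>{0..1}. \<bar>g y\<bar> \<le> 2) \<and> (\<forall>y\<in>{0..x}. g y = 1) \<and> (\<forall>y\<in>{x + d n..1 - d n}. g y = 0)" for n
      using flux_step[OF 3(1) d(1)[of n] d(2)[of n]] by blast
    then obtain g where g: "\<And>n. \<exists>k. flux (g n) k" "\<And>n y. y \<in> {0..1} \<Longrightarrow> \<bar>g n y\<bar> \<le> 2"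
      "\<And>n y. y \<in> {0..x} \<Longrightarrow> g n y = 1" "\<And>n y. y \<in> {x + d n..1 - d n} \<Longrightarrow> g n y = 0"
      by metis
    show ?thesis
    proof (rule flux_approximable_lim[where u = g and g = "\<lambda>_. 2"])
      show "flux_approximable (g n)" for n
        using g(1)[of n] flux_approximable_cong[of "g n" "g n"] flux_bounded(5) by blast
      show "(\<lambda>_. 2) \<in> L2 (dW W)" by (rule DW.L2_const)
      show "\<bar>g n s\<bar> \<le> 2" if "s \<in> {0..<1}" for n s using g(2)[of s n] that by simp
      show "(\<lambda>n. g n s) \<longlonglongrightarrow> indicator {..x} s" if s: "s \<in> {0..<1}" for s
      proof (cases "s \<le> x")
        case True
        then show ?thesis using g(3)[of s] s by simp
      next
        case False
        then have "\<forall>\<^sub>F n in sequentially. d n < min (s - x) (1 - s)"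
          using s by (intro order_tendstoD(2)[OF d_lim]) auto
        then have "\<forall>\<^sub>F n in sequentially. g n s = indicator {..x} s"
          by eventually_elim (use g(4)[of s] False in \<open>auto simp: indicator_def\<close>)
        then show ?thesis by (rule tendsto_eventually)
      qed
    qed
  qed
qed

lemma flux_approximable_L2:
  assumes "u \<in> L2 (dW W)"
  shows "flux_approximable u"
  using DW.finite_measure_axioms sets_dW assms
proof (induction rule: L2_induct)
  case (ray x) show ?case by (rule flux_approximable_ray)
next
  case (add u v)
  then have L2: "u \<in> L2 (dW W)" "v \<in> L2 (dW W)" by (auto simp: flux_approximable_def)
  show ?case
    unfolding flux_approximable_def
  proof (intro conjI allI impI DW.L2_add L2)
    fix e :: real assume e: "e > 0"
    obtain g k where g: "flux g k" "(LINT s|dW W. (u s - g s)\<^sup>2) < e / 4"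
      using add(1) e unfolding flux_approximable_def by (meson divide_pos_pos zero_less_numeral)
    obtain h l where h: "flux h l" "(LINT s|dW W. (v s - h s)\<^sup>2) < e / 4"
      using add(2) e unfolding flux_approximable_def by (meson divide_pos_pos zero_less_numeral)
    have "(LINT s|dW W. (u s - g s + (v s - h s))\<^sup>2) < e"
      using DW.integral_square_add_le[OF DW.L2_diff[OF L2(1) flux_bounded(5)[OF g(1)]]
          DW.L2_diff[OF L2(2) flux_bounded(5)[OF h(1)]]] g(2) h(2) by simp
    then have "(LINT s|dW W. (u s + v s - (g s + 1 * h s))\<^sup>2) < e"
      by (simp add: algebra_simps)
    with flux_linear[OF g(1) h(1), of 1]
    show "\<exists>g k. flux g k \<and> (LINT s|dW W. (u s + v s - g s)\<^sup>2) < e" by blast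
  qed
next
  case (cmult c u)
  then have L2: "u \<in> L2 (dW W)" by (auto simp: flux_approximable_def)
  show ?case
    unfolding flux_approximable_def
  proof (intro conjI allI impI DW.L2_cmult L2)
    fix e :: real assume e: "e > 0"
    have c: "c\<^sup>2 + 1 > 0" by (simp add: add_nonneg_pos)
    obtain g k where g: "flux g k" "(LINT s|dW W. (u s - g s)\<^sup>2) < e / (c\<^sup>2 + 1)"
      using cmult(1) e c unfolding flux_approximable_def by (meson divide_pos_pos)
    have "(LINT s|dW W. (c * u s - (0 + c * g s))\<^sup>2) = (LINT s|dW W. c\<^sup>2 * (u s - g s)\<^sup>2)"
      by (simp add: right_diff_distrib[symmetric] power_mult_distrib)
    also have "\<dots> = c\<^sup>2 * (LINT s|dW W. (u s - g s)\<^sup>2)" by simp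
    also have "\<dots> \<le> (c\<^sup>2 + 1) * (LINT s|dW W. (u s - g s)\<^sup>2)"
      by (intro mult_right_mono) auto
    also have "\<dots> < e" using g(2) c by (simp add: field_simps)
    finally show "\<exists>g k. flux g k \<and> (LINT s|dW W. (c * u s - g s)\<^sup>2) < e"
      using flux_linear[OF flux_const[of 0] g(1), of c] by blast
  qed
next
  case (lim u v g)
  then show ?case by (intro flux_approximable_lim[of u g v]) auto
qed

text \<open>
  Subtracting its mean from an approximating flux keeps it a flux, and only improves the
  approximation as the function approximated has mean zero.
\<close>

lemma flux_dense_zero_mean:
  assumes u: "u \<in> L2_zero_mean (dW W)" and e: "e > 0"
  shows "\<exists>g k. flux g k \<and> (LINT s|dW W. g s) = 0 \<and> (LINT s|dW W. (g s - u s)\<^sup>2) < e"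
proof -
  let ?w = "measure (dW W) (space (dW W))"
  have uL2: "u \<in> L2 (dW W)" and u0: "(LINT s|dW W. u s) = 0"
    using u by (auto simp: L2_zero_mean_def)
  obtain g k where g: "flux g k" "(LINT s|dW W. (u s - g s)\<^sup>2) < e"
    using flux_approximable_L2[OF uL2] e by (auto simp: flux_approximable_def)
  have gL2: "g \<in> L2 (dW W)" by (rule flux_bounded(5)[OF g(1)])
  define m where "m = (LINT s|dW W. g s) / ?w"
  have int: "integrable (dW W) u" "integrable (dW W) g"
    using DW.L2_integrable uL2 gL2 by auto
  have "?w > 0"
  proof -
    have "0 < W (1/2) - W 0" using W.W_less by simp
    also have "\<dots> = measure (dW W) {0<..1/2}"
      unfolding dW_def by (subst measure_restrict_space) (auto simp: W.measure_Ioc)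
    also have "\<dots> \<le> ?w"
      using sets.top[of "dW W"] by (intro DW.finite_measure_mono) auto
    finally show ?thesis .
  qed
  show ?thesis
  proof (intro exI conjI)
    show "flux (\<lambda>x. g x + (- 1) * m) (\<lambda>x. k x + (- 1) * 0)"
      by (rule flux_linear[OF g(1) flux_const])
    show "(LINT s|dW W. g s + (- 1) * m) = 0"
      using int \<open>?w > 0\<close> by (simp add: m_def)
    have "(LINT s|dW W. u s - g s) / ?w = - m"
      using int u0 by (simp add: m_def)
    then have "(LINT s|dW W. (u s - g s - - m)\<^sup>2) \<le> (LINT s|dW W. (u s - g s)\<^sup>2)"
      using DW.integral_square_centered_le[OF DW.L2_diff[OF uL2 gL2]] by simp
    also note g(2)
    finally show "(LINT s|dW W. (g s + (- 1) * m - u s)\<^sup>2) < e"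
      by (simp add: power2_commute algebra_simps)
  qed
qed

section \<open>The energetic space consists of primitives\<close>

lemma primitive_uniform_bound:
  assumes "u \<in> L2 (dW W)"
  shows "\<bar>LINT s:{0<..x}|dW W. u s\<bar> \<le> sqrt (measure (dW W) (space (dW W)) * (LINT s|dW W. (u s)\<^sup>2))"
proof -
  have ind: "(\<lambda>s. indicator {0<..x} s :: real) \<in> borel_measurable (dW W)" by (rule borel_dW) simp
  have int: "integrable (dW W) (\<lambda>s. \<bar>u s\<bar>)" using DW.L2_integrable[OF assms] by simp
  have "\<bar>LINT s:{0<..x}|dW W. u s\<bar> \<le> (LINT s|dW W. \<bar>indicator {0<..x} s *\<^sub>R u s\<bar>)"
    unfolding set_lebesgue_integral_def by (rule integral_abs_bound)
  also have "\<dots> \<le> (LINT s|dW W. \<bar>u s\<bar>)"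
    by (rule integral_mono'[OF int]) (auto simp: indicator_def)
  also note DW.L1_le_L2[OF assms]
  finally show ?thesis .
qed

lemma indicator_mult_L2:
  assumes "A \<in> sets borel" "u \<in> L2 (dW W)"
  shows "(\<lambda>s. indicator A s * u s) \<in> L2 (dW W)"
proof (rule DW.L2_bound[OF _ assms(2)])
  have "(\<lambda>s. indicator A s :: real) \<in> borel_measurable (dW W)"
    using assms(1) by (intro borel_dW) simp
  then show "(\<lambda>s. indicator A s * u s) \<in> borel_measurable (dW W)"
    using assms(2) by (intro borel_measurable_times) (auto simp: L2_def)
qed (auto simp: indicator_def)

lemma Ioc_integral_diff:
  assumes "F \<in> L2 (dW W)" "G \<in> L2 (dW W)"
  shows "(LINT s:{0<..x}|dW W. F s - G s) = (LINT s:{0<..x}|dW W. F s) - (LINT s:{0<..x}|dW W. G s)"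
proof -
  have "set_integrable (dW W) {0<..x} u" if "u \<in> L2 (dW W)" for u
    using DW.L2_integrable[OF indicator_mult_L2[OF _ that, of "{0<..x}"]] by (simp add: set_integrable_def)
  then show ?thesis using assms by (intro set_integral_diff) auto
qed

lemma smooth_primitive:
  assumes "flux g k" "(LINT s|dW W. g s) = 0"
  shows "smooth (\<lambda>x. c + W.primitive g x) g k"
    and "0 \<le> x \<Longrightarrow> x \<le> 1 \<Longrightarrow> c + W.primitive g x = c + (LINT s:{0<..x}|dW W. g s)"
proof -
  have g: "caglad g" "periodic1 g" using assms(1) by (auto simp: flux_def)
  have gm: "g \<in> borel_measurable borel" by (rule caglad_measurable[OF g(1)])
  obtain B where B: "\<And>x. \<bar>g x\<bar> \<le> B" using caglad_periodic_bounded[OF g] by auto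
  have "(LINT s:{0<..0 + 1}|W.mu. g s) = 0"
    using integral_dW[OF gm, of 1] integral_dW_eq[OF borel_dW[OF gm]] assms(2) by simp
  from W.periodic_primitive[OF W_periodic g this]
  have "periodic1 (\<lambda>x. c + W.primitive g x)" by (simp add: periodic1_def)
  moreover have "cadlag (\<lambda>x. c + W.primitive g x)"
    by (intro cadlag_add cadlag_const W.cadlag_primitive[OF gm B])
  moreover have "has_left_deriv W (\<lambda>x. c + W.primitive g x) g"
    using has_left_deriv_add[OF has_left_deriv_const W.has_left_deriv_primitive[OF g(1) B]] by simp
  ultimately show "smooth (\<lambda>x. c + W.primitive g x) g k"
    using assms(1) by (simp add: smooth_def)
  show "c + W.primitive g x = c + (LINT s:{0<..x}|dW W. g s)" if "0 \<le> x" "x \<le> 1"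
    using integral_dW[OF gm that] that by (simp add: W.primitive_def)
qed

text \<open>
  The constant \<open>c\<close> is the limit of the values at \<open>0\<close> of an approximating sequence.  It exists along a
  subsequence that converges almost everywhere, because at a point of convergence both the functions
  and their increments from \<open>0\<close> converge.
\<close>

lemma primitive_of_H_space:
  assumes "f \<in> H_space W V"
  shows "\<exists>F\<in>L2_zero_mean (dW W). \<exists>c. AE x in dV V. f x = c + (LINT s:{0<..x}|dW W. F s)"
proof -
  define w where "w = measure (dW W) (space (dW W))"
  define v where "v = measure (dV V) (space (dV V))"
  have fL2: "f \<in> L2 (dV V)" using assms by (simp add: H_space_def)
  obtain fs where fs: "\<And>n. fs n \<in> D_space W V"
    and conv: "(\<lambda>n. L2_norm (dV V) (\<lambda>x. fs n x - f x)) \<longlonglongrightarrow> 0"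
    and Cauchy: "\<And>e. e > 0 \<Longrightarrow> \<exists>N. \<forall>m\<ge>N. \<forall>n\<ge>N. energetic_norm W V (\<lambda>x. fs m x - fs n x) < e"
    using assms unfolding H_space_def by blast
  define g where "g n = D_left W (fs n)" for n
  have sm: "smooth (fs n) (g n) (D_right V (g n))" for n
    unfolding g_def by (rule smooth_of_D_space[OF fs])
  have gL2: "g n \<in> L2 (dW W)" for n
    using flux_bounded(5) sm by (auto simp: smooth_def)
  have "\<exists>N. \<forall>m\<ge>N. \<forall>n\<ge>N. (LINT s|dW W. (g m s - g n s)\<^sup>2) < e" if "e > 0" for e
  proof -
    have "sqrt e > 0" using that by simp
    from Cauchy[OF this]
    obtain N where N: "\<And>m n. m \<ge> N \<Longrightarrow> n \<ge> N \<Longrightarrow> energetic_norm W V (\<lambda>x. fs m x - fs n x) < sqrt e"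
      by blast
    have "(LINT s|dW W. (g m s - g n s)\<^sup>2) < e" if "m \<ge> N" "n \<ge> N" for m n
    proof -
      have "(LINT x|dV V. (fs m x - fs n x)\<^sup>2) + (LINT s|dW W. (g m s - g n s)\<^sup>2) < e"
        using N[OF that] unfolding energetic_norm_eq[OF smooth_diff[OF sm sm]] by simp
      moreover have "0 \<le> (LINT x|dV V. (fs m x - fs n x)\<^sup>2)" by simp
      ultimately show ?thesis by linarith
    qed
    then show ?thesis by blast
  qed
  from DW.L2_complete[OF gL2 this] obtain F where
    F: "F \<in> L2 (dW W)" "(\<lambda>n. LINT s|dW W. (g n s - F s)\<^sup>2) \<longlonglongrightarrow> 0" by blast
  have err: "(\<lambda>n. sqrt (w * (LINT s|dW W. (g n s - F s)\<^sup>2))) \<longlonglongrightarrow> 0"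
    using tendsto_real_sqrt[OF tendsto_mult_left[OF F(2), of w]] by simp
  have "\<bar>LINT s|dW W. F s\<bar> \<le> sqrt (w * (LINT s|dW W. (g n s - F s)\<^sup>2))" for n
  proof -
    have "(LINT s|dW W. g n s - F s) = - (LINT s|dW W. F s)"
      using DW.L2_integrable gL2 F(1) smooth_deriv_integral_zero[OF sm] by simp
    then have "\<bar>LINT s|dW W. F s\<bar> = \<bar>LINT s|dW W. g n s - F s\<bar>" by simp
    also have "\<dots> \<le> (LINT s|dW W. \<bar>g n s - F s\<bar>)" by (rule integral_abs_bound)
    also have "\<dots> \<le> sqrt (w * (LINT s|dW W. (g n s - F s)\<^sup>2))"
      unfolding w_def by (rule DW.L1_le_L2[OF DW.L2_diff[OF gL2 F(1)]])
    finally show ?thesis .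
  qed
  then have "\<bar>LINT s|dW W. F s\<bar> \<le> 0" by (intro LIMSEQ_le_const[OF err]) blast
  then have F0: "F \<in> L2_zero_mean (dW W)" using F(1) by (simp add: L2_zero_mean_def)
  define \<Phi> where "\<Phi> x = (LINT s:{0<..x}|dW W. F s)" for x
  \<comment> \<open>The error \<open>err\<close> does not depend on \<open>x\<close>.\<close>
  have unif: "(\<lambda>n. fs n x - fs n 0) \<longlonglongrightarrow> \<Phi> x" if "x \<in> {0..<1}" for x
  proof (rule LIM_zero_cancel, rule Lim_null_comparison[OF always_eventually err], rule allI)
    fix n
    have "fs n x - fs n 0 - \<Phi> x = (LINT s:{0<..x}|dW W. g n s - F s)"
      using smooth_eq_integral[OF sm[of n], of x] that Ioc_integral_diff[OF gL2 F(1)] by (simp add: \<Phi>_def)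
    then show "norm (fs n x - fs n 0 - \<Phi> x) \<le> sqrt (w * (LINT s|dW W. (g n s - F s)\<^sup>2))"
      unfolding w_def using primitive_uniform_bound[OF DW.L2_diff[OF gL2 F(1)], of x n] by simp
  qed
  have dL2: "(\<lambda>x. fs n x - f x) \<in> L2 (dV V)" for n
    by (rule DV.L2_diff[OF smooth_bounded(3)[OF sm] fL2])
  have "(\<lambda>n. LINT x|dV V. norm (fs n x - f x)) \<longlonglongrightarrow> 0"
  proof (rule tendsto_sandwich[OF always_eventually always_eventually tendsto_const])
    show "\<forall>n. (LINT x|dV V. norm (fs n x - f x)) \<le> sqrt v * L2_norm (dV V) (\<lambda>x. fs n x - f x)"
      using DV.L1_le_L2[OF dL2] by (simp add: v_def L2_norm_def L2_inner_def power2_eq_square real_sqrt_mult)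
    show "(\<lambda>n. sqrt v * L2_norm (dV V) (\<lambda>x. fs n x - f x)) \<longlonglongrightarrow> 0"
      using tendsto_mult_left[OF conv, of "sqrt v"] by simp
  qed simp
  from tendsto_L1_AE_subseq[OF DV.L2_integrable[OF dL2] this] obtain r where
    r: "strict_mono r" and AE: "AE x in dV V. (\<lambda>n. fs (r n) x - f x) \<longlonglongrightarrow> 0" by blast
  have "AE x in dV V. f x = lim (\<lambda>n. fs (r n) 0) + \<Phi> x"
    using AE AE_space
  proof eventually_elim
    case (elim x)
    have 1: "(\<lambda>n. fs (r n) x) \<longlonglongrightarrow> f x" using elim(1) by (rule LIM_zero_cancel)
    have 2: "(\<lambda>n. fs (r n) x - fs (r n) 0) \<longlonglongrightarrow> \<Phi> x"
      using LIMSEQ_subseq_LIMSEQ[OF unif r, of x] elim(2) by (simp add: o_def)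
    from tendsto_diff[OF 1 2] have "(\<lambda>n. fs (r n) 0) \<longlonglongrightarrow> f x - \<Phi> x" by simp
    then show ?case by (simp add: limI)
  qed
  then show ?thesis using F0 unfolding \<Phi>_def by blast
qed

text \<open>
  The primitives of fluxes that approximate \<open>F\<close> lie in the domain, and by the energy identity both
  the \<open>dV\<close>-distance and the energy of a difference of primitives are controlled by the $L^2_W$ norm
  of the difference of the derivatives.
\<close>

lemma H_space_of_primitive:
  assumes f: "f \<in> L2 (dV V)" and F: "F \<in> L2_zero_mean (dW W)"
    and AE: "AE x in dV V. f x = c + (LINT s:{0<..x}|dW W. F s)"
  shows "f \<in> H_space W V"
proof -
  define w where "w = measure (dW W) (space (dW W))"
  define v where "v = measure (dV V) (space (dV V))"
  have w0: "w \<ge> 0" and v0: "v \<ge> 0" by (simp_all add: w_def v_def)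
  have FL2: "F \<in> L2 (dW W)" using F by (simp add: L2_zero_mean_def)
  have "\<exists>g k. flux g k \<and> (LINT s|dW W. g s) = 0 \<and> (LINT s|dW W. (g s - F s)\<^sup>2) < 1 / (real n + 1)" for n
    by (rule flux_dense_zero_mean[OF F]) simp
  then obtain g k where g: "\<And>n. flux (g n) (k n)" "\<And>n. (LINT s|dW W. g n s) = 0"
    and close: "\<And>n. (LINT s|dW W. (g n s - F s)\<^sup>2) < 1 / (real n + 1)"
    by metis
  have gL2: "g n \<in> L2 (dW W)" for n by (rule flux_bounded(5)[OF g(1)])
  define fs where "fs n x = c + W.primitive (g n) x" for n x
  have sm: "smooth (fs n) (g n) (k n)" for n
    unfolding fs_def by (rule smooth_primitive(1)[OF g])
  have fs_eq: "fs n x = c + (LINT s:{0<..x}|dW W. g n s)" if "x \<in> {0..<1}" for n x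
    unfolding fs_def using smooth_primitive(2)[OF g] that by simp
  have square_bound: "(LINT x|dV V. (u x)\<^sup>2) \<le> v * (w * (LINT s|dW W. (h s)\<^sup>2))"
    if "h \<in> L2 (dW W)" "u \<in> L2 (dV V)" "AE x in dV V. u x = (LINT s:{0<..x}|dW W. h s)" for u h
  proof -
    have "(LINT x|dV V. (u x)\<^sup>2) \<le> (LINT x|dV V. w * (LINT s|dW W. (h s)\<^sup>2))"
    proof (rule integral_mono_AE)
      show "AE x in dV V. (u x)\<^sup>2 \<le> w * (LINT s|dW W. (h s)\<^sup>2)"
        using that(3)
      proof eventually_elim
        case (elim x)
        then have "\<bar>u x\<bar> \<le> sqrt (w * (LINT s|dW W. (h s)\<^sup>2))"
          unfolding w_def using primitive_uniform_bound[OF that(1)] by simp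
        from power_mono[OF this, of 2] show ?case using w0 by simp
      qed
    qed (use that(2) in \<open>auto simp: L2_def\<close>)
    then show ?thesis by (simp add: v_def mult_ac)
  qed
  have norm_le: "L2_norm (dV V) (\<lambda>x. fs n x - f x) \<le> sqrt (v * (w * (1 / (real n + 1))))" for n
  proof -
    have "(LINT x|dV V. (fs n x - f x)\<^sup>2) \<le> v * (w * (LINT s|dW W. (g n s - F s)\<^sup>2))"
    proof (rule square_bound[OF DW.L2_diff[OF gL2 FL2] DV.L2_diff[OF smooth_bounded(3)[OF sm] f]])
      show "AE x in dV V. fs n x - f x = (LINT s:{0<..x}|dW W. g n s - F s)"
        using AE AE_space by eventually_elim (simp add: fs_eq Ioc_integral_diff[OF gL2 FL2])
    qed
    also have "\<dots> \<le> v * (w * (1 / (real n + 1)))"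
      using close[of n] v0 w0 by (intro mult_left_mono) auto
    finally show ?thesis by (simp add: L2_norm_def L2_inner_def power2_eq_square)
  qed
  have conv: "(\<lambda>n. L2_norm (dV V) (\<lambda>x. fs n x - f x)) \<longlonglongrightarrow> 0"
  proof (rule Lim_null_comparison)
    show "\<forall>\<^sub>F n in sequentially. norm (L2_norm (dV V) (\<lambda>x. fs n x - f x)) \<le> sqrt (v * (w * (1 / (real n + 1))))"
      using norm_le by (simp add: L2_norm_def L2_inner_def)
    have "(\<lambda>n. 1 / (real n + 1)) \<longlonglongrightarrow> 0"
      using LIMSEQ_inverse_real_of_nat by (simp add: inverse_eq_divide add.commute)
    from tendsto_real_sqrt[OF tendsto_mult_left[OF tendsto_mult_left[OF this, of w], of v]]
    show "(\<lambda>n. sqrt (v * (w * (1 / (real n + 1))))) \<longlonglongrightarrow> 0" by simp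
  qed
  have energy: "energetic_norm W V (\<lambda>x. fs m x - fs n x) \<le> sqrt ((v * w + 1) * (4 / (real N + 1)))"
    if "m \<ge> N" "n \<ge> N" for m n N
  proof -
    let ?D = "LINT s|dW W. (g m s - g n s)\<^sup>2"
    have FgL2: "(\<lambda>s. F s - g n s) \<in> L2 (dW W)" by (rule DW.L2_diff[OF FL2 gL2])
    have "?D \<le> 2 * (LINT s|dW W. (g m s - F s)\<^sup>2) + 2 * (LINT s|dW W. (g n s - F s)\<^sup>2)"
      using DW.integral_square_add_le[OF DW.L2_diff[OF gL2[of m] FL2] FgL2]
      by (simp add: power2_commute)
    also have "\<dots> \<le> 2 * (1 / (real m + 1)) + 2 * (1 / (real n + 1))"
      using close[of m] close[of n] by simp
    also have "\<dots> \<le> 2 * (1 / (real N + 1)) + 2 * (1 / (real N + 1))"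
      using that by (intro add_mono mult_left_mono divide_left_mono) auto
    finally have D: "?D \<le> 4 / (real N + 1)" by simp
    have "(LINT x|dV V. (fs m x - fs n x)\<^sup>2) \<le> v * (w * ?D)"
    proof (rule square_bound[OF DW.L2_diff[OF gL2 gL2] DV.L2_diff[OF smooth_bounded(3)[OF sm] smooth_bounded(3)[OF sm]]])
      show "AE x in dV V. fs m x - fs n x = (LINT s:{0<..x}|dW W. g m s - g n s)"
        by (rule AE_I2) (simp add: fs_eq Ioc_integral_diff[OF gL2 gL2])
    qed
    then have "(LINT x|dV V. (fs m x - fs n x)\<^sup>2) + ?D \<le> (v * w + 1) * ?D"
      by (simp add: distrib_right mult.assoc)
    also have "\<dots> \<le> (v * w + 1) * (4 / (real N + 1))"
      using D v0 w0 by (intro mult_left_mono) auto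
    finally show ?thesis
      unfolding energetic_norm_eq[OF smooth_diff[OF sm sm]] by (rule real_sqrt_le_mono)
  qed
  have "\<exists>N. \<forall>m\<ge>N. \<forall>n\<ge>N. energetic_norm W V (\<lambda>x. fs m x - fs n x) < e" if "e > 0" for e
  proof -
    have "(\<lambda>N. 4 * (1 / (real N + 1))) \<longlonglongrightarrow> 4 * 0"
      using LIMSEQ_inverse_real_of_nat by (intro tendsto_mult_left) (simp add: inverse_eq_divide add.commute)
    from tendsto_real_sqrt[OF tendsto_mult_left[OF this, of "v * w + 1"]]
    have "(\<lambda>N. sqrt ((v * w + 1) * (4 / (real N + 1)))) \<longlonglongrightarrow> 0" by simp
    from order_tendstoD(2)[OF this that] obtain N where "sqrt ((v * w + 1) * (4 / (real N + 1))) < e"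
      by (auto simp: eventually_sequentially)
    then show ?thesis using energy by (meson le_less_trans)
  qed
  with f conv D_space_of_smooth(1)[OF sm] show ?thesis
    unfolding H_space_def by blast
qed

text \<open>
  Since \<open>dV\<close> charges every interval and the primitive is right-continuous, the hypothesis holds at
  every point of the circle.  At \<open>0\<close> the primitive vanishes, so the constant is \<open>0\<close> and \<open>H\<close> is
  orthogonal to all rays.  By \<open>L2_induct\<close> it is orthogonal to every square-integrable function, in
  particular to itself.
\<close>

lemma constant_primitive_imp_zero:
  assumes H: "H \<in> L2_zero_mean (dW W)" and AE: "AE x in dV V. (LINT s:{0<..x}|dW W. H s) = c"
  shows "AE x in dW W. H x = 0"
proof -
  have HL2: "H \<in> L2 (dW W)" and H0: "(LINT s|dW W. H s) = 0"
    using H by (auto simp: L2_zero_mean_def)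
  note Hint = DW.L2_integrable[OF HL2]
  define \<Phi> where "\<Phi> x = (LINT s:{0<..x}|dW W. H s)" for x
  have \<Phi>_const: "\<Phi> x = c" if x: "x \<in> {0..<1}" for x
  proof -
    \<comment> \<open>Good points accumulate at \<open>x\<close> from the right, as \<open>dV\<close> charges each interval there.\<close>
    have "\<exists>y. x < y \<and> y < x + (1 - x) / (real n + 1) \<and> \<Phi> y = c" for n
    proof (rule ccontr)
      assume no: "\<not> ?thesis"
      define b where "b = x + (1 - x) / (real n + 1)"
      have b: "x < b" "b \<le> 1"
        using x divide_left_mono[of 1 "real n + 1" "1 - x"] by (auto simp: b_def)
      have "AE y in dV V. y \<notin> {(x + b) / 2..<b}"
        using AE by eventually_elim (use no b in \<open>auto simp: b_def[symmetric] \<Phi>_def\<close>)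
      moreover have "{(x + b) / 2..<b} \<in> sets (dV V)"
        using b x by (auto simp: sets_dV sets_restrict_space intro!: image_eqI[where x = "{(x + b) / 2..<b}"])
      ultimately have "{(x + b) / 2..<b} \<in> null_sets (dV V)"
        using AE_iff_null_sets by blast
      then show False
        using emeasure_dV[of "(x + b) / 2" b] V_less[of "(x + b) / 2" b] b x by (simp add: null_sets_def)
    qed
    then obtain y where y: "\<And>n. x < y n" "\<And>n. y n < x + (1 - x) / (real n + 1)" "\<And>n. \<Phi> (y n) = c"
      by metis
    have ylim: "y \<longlonglongrightarrow> x"
    proof (rule tendsto_sandwich[OF always_eventually always_eventually tendsto_const])
      have "(\<lambda>n. x + (1 - x) * (1 / (real n + 1))) \<longlonglongrightarrow> x + (1 - x) * 0"
        using LIMSEQ_inverse_real_of_nat by (intro tendsto_intros) (simp add: inverse_eq_divide add.commute)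
      then show "(\<lambda>n. x + (1 - x) / (real n + 1)) \<longlonglongrightarrow> x" by simp
    qed (use y in \<open>auto intro: less_imp_le\<close>)
    have "(\<lambda>n. \<Phi> (y n)) \<longlonglongrightarrow> \<Phi> x"
      unfolding \<Phi>_def set_lebesgue_integral_def
    proof (rule integral_dominated_convergence)
      show "integrable (dW W) (\<lambda>s. \<bar>H s\<bar>)" using Hint by simp
      show "AE s in dW W. (\<lambda>n. indicator {0<..y n} s *\<^sub>R H s) \<longlonglongrightarrow> indicator {0<..x} s *\<^sub>R H s"
      proof (rule AE_I2)
        fix s
        have "\<forall>\<^sub>F n in sequentially. indicator {0<..y n} s = (indicator {0<..x} s :: real)"
        proof (cases "s \<le> x")
          case True
          then show ?thesis using y(1) by (intro always_eventually) (auto simp: indicator_def intro: less_imp_le le_less_trans)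
        next
          case False
          then have "\<forall>\<^sub>F n in sequentially. y n < s" by (intro order_tendstoD(2)[OF ylim]) simp
          then show ?thesis by eventually_elim (use False in \<open>auto simp: indicator_def\<close>)
        qed
        then show "(\<lambda>n. indicator {0<..y n} s *\<^sub>R H s) \<longlonglongrightarrow> indicator {0<..x} s *\<^sub>R H s"
          by (intro tendsto_scaleR tendsto_const tendsto_eventually)
      qed
      have meas: "(\<lambda>s. indicator {0<..b} s *\<^sub>R H s) \<in> borel_measurable (dW W)" for b
        using indicator_mult_L2[OF _ HL2, of "{0<..b}"] by (simp add: L2_def)
      show "(\<lambda>s. indicator {0<..x} s *\<^sub>R H s) \<in> borel_measurable (dW W)"
        and "(\<lambda>s. indicator {0<..y n} s *\<^sub>R H s) \<in> borel_measurable (dW W)" for n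
        by (rule meas)+
    qed (auto simp: indicator_def)
    then show ?thesis using y(3) by (simp add: LIMSEQ_const_iff)
  qed
  have \<Phi>0: "\<Phi> x = 0" if "x \<in> {0..<1}" for x
    using \<Phi>_const[OF that] \<Phi>_const[of 0] by (simp add: \<Phi>_def set_lebesgue_integral_def)
  have "H \<in> L2 (dW W) \<and> (LINT s|dW W. H s * H s) = 0"
    using DW.finite_measure_axioms sets_dW HL2
  proof (induction rule: L2_induct[where P = "\<lambda>u. u \<in> L2 (dW W) \<and> (LINT s|dW W. H s * u s) = 0"])
    case (ray x)
    have ind: "(\<lambda>s. indicator {..x} s :: real) \<in> borel_measurable (dW W)" by (rule borel_dW) simp
    consider "x < 0" | "1 \<le> x" | "x \<in> {0..<1}" by fastforce
    then have "(LINT s|dW W. H s * indicator {..x} s) = 0"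
    proof cases
      case 1
      then have "(LINT s|dW W. H s * indicator {..x} s) = (LINT s|dW W. 0)"
        by (intro Bochner_Integration.integral_cong) (auto simp: indicator_def)
      then show ?thesis by simp
    next
      case 2
      then have "(LINT s|dW W. H s * indicator {..x} s) = (LINT s|dW W. H s)"
        by (intro Bochner_Integration.integral_cong) (auto simp: indicator_def)
      then show ?thesis using H0 by simp
    next
      case 3
      have "(LINT s|dW W. H s * indicator {..x} s) = (LINT s|dW W. indicator {0<..x} s * H s)"
      proof (rule integral_cong_AE)
        show "AE s in dW W. H s * indicator {..x} s = indicator {0<..x} s * H s"
          using AE_dW_nonzero by eventually_elim (auto simp: indicator_def)
      qed (use ind HL2 indicator_mult_L2[OF _ HL2, of "{0<..x}"] in \<open>auto simp: L2_def\<close>)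
      then show ?thesis using \<Phi>0[OF 3] by (simp add: \<Phi>_def set_lebesgue_integral_def)
    qed
    then show ?case using indicator_atMost_L2 by simp
  next
    case (add u v)
    then show ?case
      using DW.L2_mult_integrable[OF HL2] DW.L2_add by (simp add: distrib_left)
  next
    case (cmult c u)
    then show ?case using DW.L2_cmult[of u c] by (simp add: mult.left_commute)
  next
    case (lim u v g)
    have um: "u n \<in> borel_measurable (dW W)" for n using lim(1)[of n] by (simp add: L2_def)
    have vm: "v \<in> borel_measurable (dW W)"
      by (rule borel_measurable_LIMSEQ_real[where u = u]) (use lim(4) um in auto)
    have v_le: "\<bar>v s\<bar> \<le> g s" if "s \<in> space (dW W)" for s
      by (rule LIMSEQ_le_const2[OF tendsto_rabs[OF lim(4)[OF that]]]) (use lim(3) that in blast)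
    have vL2: "v \<in> L2 (dW W)"
      by (rule DW.L2_bound[OF vm lim(2)]) (use v_le in \<open>auto intro: order_trans[OF _ abs_ge_self]\<close>)
    have "(\<lambda>n. LINT s|dW W. H s * u n s) \<longlonglongrightarrow> (LINT s|dW W. H s * v s)"
    proof (rule integral_dominated_convergence)
      have "(\<lambda>s. \<bar>H s\<bar>) \<in> L2 (dW W)" using HL2 by (auto simp: L2_def)
      from DW.L2_mult_integrable[OF this lim(2)] show "integrable (dW W) (\<lambda>s. \<bar>H s\<bar> * g s)" .
      show "AE s in dW W. (\<lambda>n. H s * u n s) \<longlonglongrightarrow> H s * v s"
        using lim(4) by (intro AE_I2 tendsto_mult_left)
      show "AE s in dW W. norm (H s * u n s) \<le> \<bar>H s\<bar> * g s" for n
        using lim(3) by (intro AE_I2) (auto simp: abs_mult intro!: mult_left_mono)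
    qed (use HL2 um vm in \<open>auto simp: L2_def\<close>)
    then show ?case using vL2 lim(1) by (simp add: LIMSEQ_const_iff)
  qed
  then have "(LINT s|dW W. (H s)\<^sup>2) = 0" by (simp add: power2_eq_square)
  then have "AE s in dW W. (H s)\<^sup>2 = 0"
    using HL2 by (subst (asm) integral_nonneg_eq_0_iff_AE) (auto simp: L2_def)
  then show ?thesis by simp
qed

end

theorem theorem2:
  fixes W V f :: "real \<Rightarrow> real"
  assumes "strict_mono W" and "cadlag W" and "periodic_increments W"
    and "isCont W 0" and "W 0 = 0"
    and "strict_mono V" and "caglad V" and "periodic_increments V"
    and "isCont V 0" and "V 0 = 0"
    and "f \<in> L2 (dV V)"
  shows "(f \<in> H_space W V \<longleftrightarrow>
           (\<exists>F \<in> L2_zero_mean (dW W). \<exists>c::real.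
              AE x in dV V. f x = c + (LINT s:{0<..x}|dW W. F s))) \<and>
         (\<forall>F \<in> L2_zero_mean (dW W). \<forall>G \<in> L2_zero_mean (dW W). \<forall>c d :: real.
            (AE x in dV V. f x = c + (LINT s:{0<..x}|dW W. F s)) \<longrightarrow>
            (AE x in dV V. f x = d + (LINT s:{0<..x}|dW W. G s)) \<longrightarrow>
            (AE x in dW W. F x = G x))"
proof -
  interpret circle_clocks W V
    by (rule circle_clocks.intro) fact+
  show ?thesis
  proof (intro conjI ballI allI impI)
    show "f \<in> H_space W V \<longleftrightarrow>
        (\<exists>F\<in>L2_zero_mean (dW W). \<exists>c. AE x in dV V. f x = c + (LINT s:{0<..x}|dW W. F s))"
      using primitive_of_H_space H_space_of_primitive[OF \<open>f \<in> L2 (dV V)\<close>] by blast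
  next
    fix F G and c d :: real
    assume F: "F \<in> L2_zero_mean (dW W)" and G: "G \<in> L2_zero_mean (dW W)"
      and fF: "AE x in dV V. f x = c + (LINT s:{0<..x}|dW W. F s)"
      and fG: "AE x in dV V. f x = d + (LINT s:{0<..x}|dW W. G s)"
    have L2: "F \<in> L2 (dW W)" "G \<in> L2 (dW W)" using F G by (auto simp: L2_zero_mean_def)
    have "(\<lambda>s. F s - G s) \<in> L2_zero_mean (dW W)"
      using F G DW.L2_diff[OF L2] DW.L2_integrable[OF L2(1)] DW.L2_integrable[OF L2(2)]
      by (simp add: L2_zero_mean_def)
    moreover have "AE x in dV V. (LINT s:{0<..x}|dW W. F s - G s) = d - c"
      using fF fG by eventually_elim (simp add: Ioc_integral_diff[OF L2])
    ultimately have "AE x in dW W. F x - G x = 0" by (rule constant_primitive_imp_zero)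
    then show "AE x in dW W. F x = G x" by simp
  qed
qed

end
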